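(* The variety $\mathsf{DHA}$ is canonical: for every $A\in\mathsf{DHA}$, the Heyting algebra $\mathrm{Up}(X_A)$ belongs to $\mathsf{DHA}$.
   Context: $X_A$ is the poset of prime filters of $A$ ordered by inclusion. For a poset $X$, $\mathrm{Up}(X)$ is the Heyting algebra of upsets of $X$ ($U\to V=\{x:{\uparrow}x\cap U\subseteq V\}$, ${\uparrow}x=\{y:x\le y\}$). A poset satisfies the three point rule if for all distinct $x,y,z$, if $x,y$ are incomparable and $x\le z$ then $y\le z$. A poset $X$ is a diamond system if: (D1) each ${\uparrow}x$ satisfies the three point rule; (D2) no ${\uparrow}x$ contains a $3$-element antichain; (D3) for all $x$ and $y,z\in{\uparrow}x$ there is $w$ with $y,z\le w$; (D4) whenever $\bot\le x,y$, $x,y\le z,v$, $z,v\le\top$, there is $w$ with $x,y\le w\le z,v$. A diamond sequence is a diamond system in which any two elements have a common lower bound. $\mathsf{DHA}$ is the variety generated by $\{\mathrm{Up}(X): X$ a finite diamond sequence$\}$. *)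

theory Defs
  imports "HOL-Algebra.Lattice"
begin

section \<open>Heyting algebras\<close>

record 'a heyting = "'a gorder" +
  himp :: "'a \<Rightarrow> 'a \<Rightarrow> 'a"

locale heyting_algebra = bounded_lattice L for L :: "('a, 'm) heyting_scheme" (structure) +
  assumes himp_closed:
      "\<lbrakk>a \<in> carrier L; b \<in> carrier L\<rbrakk> \<Longrightarrow> himp L a b \<in> carrier L"
    and himp_residual:
      "\<lbrakk>a \<in> carrier L; b \<in> carrier L; c \<in> carrier L\<rbrakk>
        \<Longrightarrow> c \<sqinter> a \<sqsubseteq> b \<longleftrightarrow> c \<sqsubseteq> himp L a b"


section \<open>The variety generated by a class of Heyting algebras\<close>

datatype 'v hterm =
    Var 'v
  | Bot
  | Top
  | Meet "'v hterm" "'v hterm"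
  | Join "'v hterm" "'v hterm"
  | Imp "'v hterm" "'v hterm"

primrec hval :: "('a, 'm) heyting_scheme \<Rightarrow> ('v \<Rightarrow> 'a) \<Rightarrow> 'v hterm \<Rightarrow> 'a" where
  "hval L \<sigma> (Var n) = \<sigma> n"
| "hval L \<sigma> Bot = \<bottom>\<^bsub>L\<^esub>"
| "hval L \<sigma> Top = \<top>\<^bsub>L\<^esub>"
| "hval L \<sigma> (Meet s t) = hval L \<sigma> s \<sqinter>\<^bsub>L\<^esub> hval L \<sigma> t"
| "hval L \<sigma> (Join s t) = hval L \<sigma> s \<squnion>\<^bsub>L\<^esub> hval L \<sigma> t"
| "hval L \<sigma> (Imp s t) = himp L (hval L \<sigma> s) (hval L \<sigma> t)"

definition satisfies :: "('a, 'm) heyting_scheme \<Rightarrow> (nat hterm \<times> nat hterm) set \<Rightarrow> bool" where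
  "satisfies L E \<longleftrightarrow>
     (\<forall>(s, t)\<in>E. \<forall>\<sigma>. range \<sigma> \<subseteq> carrier L \<longrightarrow> hval L \<sigma> s = hval L \<sigma> t)"

text \<open>
  Varieties are equational classes, and the variety generated by \<open>K\<close> is the smallest one
  containing \<open>K\<close>, that is, the intersection of the classes of all Heyting algebras satisfying
  \<open>E\<close>, for those \<open>E\<close> that hold throughout \<open>K\<close>.  A class closed under homomorphic images,
  subalgebras and products would have to range over algebras of all types at once.  Theorem
  \<open>variety_generated_iff_HSP\<close> below shows that, for Heyting algebras on any fixed type, the members
  of the generated variety are exactly the homomorphic images of subalgebras of products of
  members of \<open>K\<close>.
\<close>

definition variety_generated :: "'b heyting set \<Rightarrow> 'a heyting set" where
  "variety_generated K =
     {A. heyting_algebra A \<and> (\<forall>E. (\<forall>B\<in>K. satisfies B E) \<longrightarrow> satisfies A E)}"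


section \<open>Upsets and prime filters\<close>

definition up :: "('a, 'm) gorder_scheme \<Rightarrow> 'a \<Rightarrow> 'a set" where
  "up X x = {y \<in> carrier X. x \<sqsubseteq>\<^bsub>X\<^esub> y}"

definition upset :: "('a, 'm) gorder_scheme \<Rightarrow> 'a set \<Rightarrow> bool" where
  "upset X U \<longleftrightarrow> U \<subseteq> carrier X \<and> (\<forall>x\<in>U. up X x \<subseteq> U)"

definition Up :: "('a, 'm) gorder_scheme \<Rightarrow> 'a set heyting" where
  "Up X = \<lparr>carrier = {U. upset X U}, eq = (=), le = (\<subseteq>),
           himp = (\<lambda>U V. {x \<in> carrier X. up X x \<inter> U \<subseteq> V})\<rparr>"

definition prime_filter :: "('a, 'm) gorder_scheme \<Rightarrow> 'a set \<Rightarrow> bool" where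
  "prime_filter A F \<longleftrightarrow>
     F \<subseteq> carrier A \<and> F \<noteq> {} \<and> F \<noteq> carrier A \<and>
     (\<forall>a\<in>F. \<forall>b\<in>carrier A. a \<sqsubseteq>\<^bsub>A\<^esub> b \<longrightarrow> b \<in> F) \<and>
     (\<forall>a\<in>F. \<forall>b\<in>F. a \<sqinter>\<^bsub>A\<^esub> b \<in> F) \<and>
     (\<forall>a\<in>carrier A. \<forall>b\<in>carrier A. a \<squnion>\<^bsub>A\<^esub> b \<in> F \<longrightarrow> a \<in> F \<or> b \<in> F)"

definition prime_spectrum :: "('a, 'm) gorder_scheme \<Rightarrow> 'a set gorder" where
  "prime_spectrum A = \<lparr>carrier = {F. prime_filter A F}, eq = (=), le = (\<subseteq>)\<rparr>"


section \<open>Diamond systems and diamond sequences\<close>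

definition incomparable :: "('a, 'm) gorder_scheme \<Rightarrow> 'a \<Rightarrow> 'a \<Rightarrow> bool" where
  "incomparable X x y \<longleftrightarrow> \<not> x \<sqsubseteq>\<^bsub>X\<^esub> y \<and> \<not> y \<sqsubseteq>\<^bsub>X\<^esub> x"

definition three_point_rule :: "('a, 'm) gorder_scheme \<Rightarrow> bool" where
  "three_point_rule X \<longleftrightarrow>
     (\<forall>x\<in>carrier X. \<forall>y\<in>carrier X. \<forall>z\<in>carrier X.
        x \<noteq> y \<and> x \<noteq> z \<and> y \<noteq> z \<longrightarrow>
        incomparable X x y \<longrightarrow> x \<sqsubseteq>\<^bsub>X\<^esub> z \<longrightarrow> y \<sqsubseteq>\<^bsub>X\<^esub> z)"

definition antichain :: "('a, 'm) gorder_scheme \<Rightarrow> 'a set \<Rightarrow> bool" where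
  "antichain X S \<longleftrightarrow>
     S \<subseteq> carrier X \<and> (\<forall>x\<in>S. \<forall>y\<in>S. x \<noteq> y \<longrightarrow> incomparable X x y)"

locale diamond_system = partial_order X for X (structure) +
  assumes D1: "x \<in> carrier X \<Longrightarrow> three_point_rule (X\<lparr>carrier := up X x\<rparr>)"
    and D2: "x \<in> carrier X \<Longrightarrow> \<not> (\<exists>S. S \<subseteq> up X x \<and> antichain X S \<and> card S = 3)"
    and D3: "\<lbrakk>x \<in> carrier X; y \<in> up X x; z \<in> up X x\<rbrakk>
              \<Longrightarrow> \<exists>w\<in>carrier X. y \<sqsubseteq> w \<and> z \<sqsubseteq> w"
    and D4: "\<lbrakk>b \<in> carrier X; x \<in> carrier X; y \<in> carrier X;
              z \<in> carrier X; v \<in> carrier X; t \<in> carrier X;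
              b \<sqsubseteq> x; b \<sqsubseteq> y; x \<sqsubseteq> z; x \<sqsubseteq> v; y \<sqsubseteq> z; y \<sqsubseteq> v; z \<sqsubseteq> t; v \<sqsubseteq> t\<rbrakk>
              \<Longrightarrow> \<exists>w\<in>carrier X. x \<sqsubseteq> w \<and> y \<sqsubseteq> w \<and> w \<sqsubseteq> z \<and> w \<sqsubseteq> v"

locale diamond_sequence = diamond_system +
  assumes common_lower_bound:
    "\<lbrakk>x \<in> carrier X; y \<in> carrier X\<rbrakk> \<Longrightarrow> \<exists>w\<in>carrier X. w \<sqsubseteq> x \<and> w \<sqsubseteq> y"

text \<open>Every finite poset is isomorphic to one whose elements are natural numbers.\<close>

definition DHA :: "'a heyting set" where
  "DHA = variety_generated {Up X | X :: nat gorder. finite (carrier X) \<and> diamond_sequence X}"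


section \<open>Consistency of the definitions\<close>

lemma (in partial_order) meet_eqI:
  assumes "x \<in> carrier L" "y \<in> carrier L" "z \<in> carrier L" "z \<sqsubseteq> x" "z \<sqsubseteq> y"
    and "\<And>w. \<lbrakk>w \<in> carrier L; w \<sqsubseteq> x; w \<sqsubseteq> y\<rbrakk> \<Longrightarrow> w \<sqsubseteq> z"
  shows "x \<sqinter> y = z"
proof -
  have "greatest L z (Lower L {x, y})"
    using assms by (intro greatest_LowerI) (auto simp: Lower_def)
  then show ?thesis
    unfolding meet_def inf_def by (metis (no_types, lifting) greatest_unique someI)
qed

lemma (in partial_order) join_eqI:
  assumes "x \<in> carrier L" "y \<in> carrier L" "z \<in> carrier L" "x \<sqsubseteq> z" "y \<sqsubseteq> z"
    and "\<And>w. \<lbrakk>w \<in> carrier L; x \<sqsubseteq> w; y \<sqsubseteq> w\<rbrakk> \<Longrightarrow> z \<sqsubseteq> w"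
  shows "x \<squnion> y = z"
proof -
  have "least L z (Upper L {x, y})"
    using assms by (intro least_UpperI) (auto simp: Upper_def)
  then show ?thesis
    unfolding join_def sup_def by (metis (no_types, lifting) least_unique someI)
qed

lemma (in partial_order) bottom_eqI:
  assumes "z \<in> carrier L" "\<And>w. w \<in> carrier L \<Longrightarrow> z \<sqsubseteq> w"
  shows "\<bottom> = z"
proof -
  have "least L z (carrier L)"
    using assms by (auto simp: least_def)
  then show ?thesis
    unfolding bottom_def by (metis (no_types, lifting) least_unique someI)
qed

lemma (in partial_order) top_eqI:
  assumes "z \<in> carrier L" "\<And>w. w \<in> carrier L \<Longrightarrow> w \<sqsubseteq> z"
  shows "\<top> = z"
proof -
  have "greatest L z (carrier L)"
    using assms by (auto simp: greatest_def)
  then show ?thesis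
    unfolding top_def by (metis (no_types, lifting) greatest_unique someI)
qed

subsection \<open>\<open>Up X\<close> is a Heyting algebra\<close>

lemma partial_order_Up: "partial_order (Up X)"
  by unfold_locales (auto simp: Up_def)

lemma
  assumes "upset X U" "upset X V"
  shows Up_meet: "U \<sqinter>\<^bsub>Up X\<^esub> V = U \<inter> V"
    and Up_join: "U \<squnion>\<^bsub>Up X\<^esub> V = U \<union> V"
proof -
  interpret partial_order "Up X" by (rule partial_order_Up)
  show "U \<sqinter>\<^bsub>Up X\<^esub> V = U \<inter> V"
    using assms by (intro meet_eqI) (auto simp: Up_def upset_def)
  show "U \<squnion>\<^bsub>Up X\<^esub> V = U \<union> V"
    using assms by (intro join_eqI) (auto simp: Up_def upset_def)
qed

lemma Up_bottom: "\<bottom>\<^bsub>Up X\<^esub> = {}"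
  and Up_top: "\<top>\<^bsub>Up X\<^esub> = carrier X"
proof -
  interpret partial_order "Up X" by (rule partial_order_Up)
  show "\<bottom>\<^bsub>Up X\<^esub> = {}"
    by (intro bottom_eqI) (auto simp: Up_def upset_def)
  show "\<top>\<^bsub>Up X\<^esub> = carrier X"
    by (intro top_eqI) (auto simp: Up_def upset_def up_def)
qed

lemma heyting_algebra_Up:
  assumes "partial_order X"
  shows "heyting_algebra (Up X)"
proof -
  interpret X: partial_order X by fact
  interpret partial_order "Up X" by (rule partial_order_Up)
  show ?thesis
  proof unfold_locales
    fix U V assume UV: "U \<in> carrier (Up X)" "V \<in> carrier (Up X)"
    show "\<exists>s. least (Up X) s (Upper (Up X) {U, V})"
      using UV by (intro exI[of _ "U \<union> V"] least_UpperI) (auto simp: Up_def upset_def Upper_def)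
    show "\<exists>s. greatest (Up X) s (Lower (Up X) {U, V})"
      using UV by (intro exI[of _ "U \<inter> V"] greatest_LowerI) (auto simp: Up_def upset_def Lower_def)
    show "himp (Up X) U V \<in> carrier (Up X)"
      using UV by (auto simp: Up_def upset_def up_def dest: X.le_trans)
    fix W assume W: "W \<in> carrier (Up X)"
    show "(W \<sqinter>\<^bsub>Up X\<^esub> U \<sqsubseteq>\<^bsub>Up X\<^esub> V) = (W \<sqsubseteq>\<^bsub>Up X\<^esub> himp (Up X) U V)"
    proof -
      have *: "upset X U" "upset X W" using UV W by (auto simp: Up_def)
      have "(W \<inter> U \<subseteq> V) = (W \<subseteq> {x \<in> carrier X. up X x \<inter> U \<subseteq> V})"
      proof
        assume "W \<inter> U \<subseteq> V"
        then show "W \<subseteq> {x \<in> carrier X. up X x \<inter> U \<subseteq> V}"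
          using * unfolding upset_def by blast
      next
        assume "W \<subseteq> {x \<in> carrier X. up X x \<inter> U \<subseteq> V}"
        moreover have "x \<in> up X x" if "x \<in> W" for x
          using that * by (auto simp: upset_def up_def)
        ultimately show "W \<inter> U \<subseteq> V" by blast
      qed
      then show ?thesis using * Up_meet[of X W U] by (simp add: Up_def)
    qed
  next
    show "\<exists>x. least (Up X) x (carrier (Up X))"
      by (intro exI[of _ "{}"]) (auto simp: Up_def upset_def least_def)
    show "\<exists>x. greatest (Up X) x (carrier (Up X))"
      by (intro exI[of _ "carrier X"]) (auto simp: Up_def upset_def up_def greatest_def)
  qed
qed

lemma partial_order_prime_spectrum: "partial_order (prime_spectrum A)"
  by unfold_locales (auto simp: prime_spectrum_def)

subsection \<open>Homomorphic images of subalgebras of products\<close>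

definition subalgebra :: "'a set \<Rightarrow> ('a, 'm) heyting_scheme \<Rightarrow> bool" where
  "subalgebra S L \<longleftrightarrow>
     S \<subseteq> carrier L \<and> \<bottom>\<^bsub>L\<^esub> \<in> S \<and> \<top>\<^bsub>L\<^esub> \<in> S \<and>
     (\<forall>a\<in>S. \<forall>b\<in>S. a \<sqinter>\<^bsub>L\<^esub> b \<in> S \<and> a \<squnion>\<^bsub>L\<^esub> b \<in> S \<and> himp L a b \<in> S)"

definition heyting_hom_on ::
    "'a set \<Rightarrow> ('a, 'm) heyting_scheme \<Rightarrow> ('b, 'n) heyting_scheme \<Rightarrow> ('a \<Rightarrow> 'b) \<Rightarrow> bool" where
  "heyting_hom_on S L M h \<longleftrightarrow>
     h \<in> S \<rightarrow> carrier M \<and> h \<bottom>\<^bsub>L\<^esub> = \<bottom>\<^bsub>M\<^esub> \<and> h \<top>\<^bsub>L\<^esub> = \<top>\<^bsub>M\<^esub> \<and>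
     (\<forall>a\<in>S. \<forall>b\<in>S. h (a \<sqinter>\<^bsub>L\<^esub> b) = h a \<sqinter>\<^bsub>M\<^esub> h b \<and>
                   h (a \<squnion>\<^bsub>L\<^esub> b) = h a \<squnion>\<^bsub>M\<^esub> h b \<and>
                   h (himp L a b) = himp M (h a) (h b))"

definition heyting_product ::
    "'i set \<Rightarrow> ('i \<Rightarrow> ('a, 'm) heyting_scheme) \<Rightarrow> ('i \<Rightarrow> 'a) heyting" where
  "heyting_product I B =
     \<lparr>carrier = (\<Pi>\<^sub>E i\<in>I. carrier (B i)), eq = (=), le = (\<lambda>f g. \<forall>i\<in>I. f i \<sqsubseteq>\<^bsub>B i\<^esub> g i),
      himp = (\<lambda>f g. \<lambda>i\<in>I. himp (B i) (f i) (g i))\<rparr>"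

lemma (in heyting_algebra) hval_closed:
  assumes "\<sigma> ` set_hterm t \<subseteq> carrier L"
  shows "hval L \<sigma> t \<in> carrier L"
  using assms by (induction t) (simp_all add: image_Un himp_closed)

lemma hval_map: "hval L \<sigma> (map_hterm f t) = hval L (\<sigma> \<circ> f) t"
  by (induction t) auto

lemma hval_cong: "(\<And>x. x \<in> set_hterm t \<Longrightarrow> \<sigma> x = \<tau> x) \<Longrightarrow> hval L \<sigma> t = hval L \<tau> t"
  by (induction t) auto

lemma heyting_product_ops:
  assumes B: "\<And>i. i \<in> I \<Longrightarrow> heyting_algebra (B i)"
  defines "P \<equiv> heyting_product I B"
  shows "\<bottom>\<^bsub>P\<^esub> = (\<lambda>i\<in>I. \<bottom>\<^bsub>B i\<^esub>)"
    and "\<top>\<^bsub>P\<^esub> = (\<lambda>i\<in>I. \<top>\<^bsub>B i\<^esub>)"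
    and "\<lbrakk>f \<in> carrier P; g \<in> carrier P\<rbrakk> \<Longrightarrow> f \<sqinter>\<^bsub>P\<^esub> g = (\<lambda>i\<in>I. f i \<sqinter>\<^bsub>B i\<^esub> g i)"
    and "\<lbrakk>f \<in> carrier P; g \<in> carrier P\<rbrakk> \<Longrightarrow> f \<squnion>\<^bsub>P\<^esub> g = (\<lambda>i\<in>I. f i \<squnion>\<^bsub>B i\<^esub> g i)"
    and "himp P f g = (\<lambda>i\<in>I. himp (B i) (f i) (g i))"
proof -
  have po: "partial_order (B i)" if "i \<in> I" for i
  proof -
    interpret heyting_algebra "B i" using that by (rule B)
    show ?thesis by unfold_locales
  qed
  have wpo: "weak_partial_order (B i)" if "i \<in> I" for i
    using partial_order.axioms(1)[OF po[OF that]] .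
  have bt: "\<bottom>\<^bsub>B i\<^esub> \<in> carrier (B i)" "\<top>\<^bsub>B i\<^esub> \<in> carrier (B i)"
    "a \<in> carrier (B i) \<Longrightarrow> \<bottom>\<^bsub>B i\<^esub> \<sqsubseteq>\<^bsub>B i\<^esub> a" "a \<in> carrier (B i) \<Longrightarrow> a \<sqsubseteq>\<^bsub>B i\<^esub> \<top>\<^bsub>B i\<^esub>"
    if "i \<in> I" for i a
  proof -
    interpret heyting_algebra "B i" using that by (rule B)
    show "\<bottom>\<^bsub>B i\<^esub> \<in> carrier (B i)" "\<top>\<^bsub>B i\<^esub> \<in> carrier (B i)"
      "a \<in> carrier (B i) \<Longrightarrow> \<bottom>\<^bsub>B i\<^esub> \<sqsubseteq>\<^bsub>B i\<^esub> a" "a \<in> carrier (B i) \<Longrightarrow> a \<sqsubseteq>\<^bsub>B i\<^esub> \<top>\<^bsub>B i\<^esub>"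
      by simp_all
  qed
  have mj: "a \<sqinter>\<^bsub>B i\<^esub> b \<in> carrier (B i)" "a \<squnion>\<^bsub>B i\<^esub> b \<in> carrier (B i)"
    "a \<sqinter>\<^bsub>B i\<^esub> b \<sqsubseteq>\<^bsub>B i\<^esub> a" "a \<sqinter>\<^bsub>B i\<^esub> b \<sqsubseteq>\<^bsub>B i\<^esub> b"
    "a \<sqsubseteq>\<^bsub>B i\<^esub> a \<squnion>\<^bsub>B i\<^esub> b" "b \<sqsubseteq>\<^bsub>B i\<^esub> a \<squnion>\<^bsub>B i\<^esub> b"
    "\<lbrakk>c \<in> carrier (B i); c \<sqsubseteq>\<^bsub>B i\<^esub> a; c \<sqsubseteq>\<^bsub>B i\<^esub> b\<rbrakk> \<Longrightarrow> c \<sqsubseteq>\<^bsub>B i\<^esub> a \<sqinter>\<^bsub>B i\<^esub> b"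
    "\<lbrakk>c \<in> carrier (B i); a \<sqsubseteq>\<^bsub>B i\<^esub> c; b \<sqsubseteq>\<^bsub>B i\<^esub> c\<rbrakk> \<Longrightarrow> a \<squnion>\<^bsub>B i\<^esub> b \<sqsubseteq>\<^bsub>B i\<^esub> c"
    if "i \<in> I" "a \<in> carrier (B i)" "b \<in> carrier (B i)" for i a b c
  proof -
    interpret heyting_algebra "B i" using that(1) by (rule B)
    show "a \<sqinter>\<^bsub>B i\<^esub> b \<in> carrier (B i)" "a \<squnion>\<^bsub>B i\<^esub> b \<in> carrier (B i)"
      "a \<sqinter>\<^bsub>B i\<^esub> b \<sqsubseteq>\<^bsub>B i\<^esub> a" "a \<sqinter>\<^bsub>B i\<^esub> b \<sqsubseteq>\<^bsub>B i\<^esub> b"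
      "a \<sqsubseteq>\<^bsub>B i\<^esub> a \<squnion>\<^bsub>B i\<^esub> b" "b \<sqsubseteq>\<^bsub>B i\<^esub> a \<squnion>\<^bsub>B i\<^esub> b"
      "\<lbrakk>c \<in> carrier (B i); c \<sqsubseteq>\<^bsub>B i\<^esub> a; c \<sqsubseteq>\<^bsub>B i\<^esub> b\<rbrakk> \<Longrightarrow> c \<sqsubseteq>\<^bsub>B i\<^esub> a \<sqinter>\<^bsub>B i\<^esub> b"
      "\<lbrakk>c \<in> carrier (B i); a \<sqsubseteq>\<^bsub>B i\<^esub> c; b \<sqsubseteq>\<^bsub>B i\<^esub> c\<rbrakk> \<Longrightarrow> a \<squnion>\<^bsub>B i\<^esub> b \<sqsubseteq>\<^bsub>B i\<^esub> c"
      using that(2,3) by (simp_all add: meet_left meet_right join_left join_right meet_le join_le)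
  qed
  have carr: "h \<in> carrier P \<longleftrightarrow> h \<in> (\<Pi>\<^sub>E i\<in>I. carrier (B i))"
    and le: "h \<sqsubseteq>\<^bsub>P\<^esub> k \<longleftrightarrow> (\<forall>i\<in>I. h i \<sqsubseteq>\<^bsub>B i\<^esub> k i)"
    and eq: "h .=\<^bsub>P\<^esub> k \<longleftrightarrow> h = k" for h k
    by (simp_all add: P_def heyting_product_def)
  have c: "h i \<in> carrier (B i)" if "h \<in> carrier P" "i \<in> I" for h i
    using that by (auto simp: carr)
  interpret P: partial_order P
  proof unfold_locales
    fix x y assume *: "x \<sqsubseteq>\<^bsub>P\<^esub> y" "y \<sqsubseteq>\<^bsub>P\<^esub> x" "x \<in> carrier P" "y \<in> carrier P"
    have "x i = y i" if "i \<in> I" for i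
      using * c that partial_order.le_antisym[OF po[OF that]] by (simp add: le)
    then show "x .=\<^bsub>P\<^esub> y"
      using * unfolding eq carr by (intro PiE_ext)
  next
    fix x y z
    assume *: "x \<sqsubseteq>\<^bsub>P\<^esub> y" "y \<sqsubseteq>\<^bsub>P\<^esub> z" "x \<in> carrier P" "y \<in> carrier P" "z \<in> carrier P"
    show "x \<sqsubseteq>\<^bsub>P\<^esub> z"
      unfolding le
    proof
      fix i assume i: "i \<in> I"
      show "x i \<sqsubseteq>\<^bsub>B i\<^esub> z i"
        using weak_partial_order.le_trans[OF wpo[OF i], of "x i" "y i" "z i"] * c i
        by (simp add: le)
    qed
  next
    fix x assume "x \<in> carrier P"
    then show "x \<sqsubseteq>\<^bsub>P\<^esub> x"
      using c weak_partial_order.le_refl[OF wpo] by (simp add: le)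
  next
    show "(.=\<^bsub>P\<^esub>) = (=)" by (intro ext) (rule eq)
  qed (simp_all add: eq)
  show "himp P f g = (\<lambda>i\<in>I. himp (B i) (f i) (g i))"
    by (simp add: P_def heyting_product_def)
  show "\<bottom>\<^bsub>P\<^esub> = (\<lambda>i\<in>I. \<bottom>\<^bsub>B i\<^esub>)"
    by (rule P.bottom_eqI) (use bt c in \<open>simp_all add: carr le\<close>)
  show "\<top>\<^bsub>P\<^esub> = (\<lambda>i\<in>I. \<top>\<^bsub>B i\<^esub>)"
    by (rule P.top_eqI) (use bt c in \<open>simp_all add: carr le\<close>)
  assume fg: "f \<in> carrier P" "g \<in> carrier P"
  show "f \<sqinter>\<^bsub>P\<^esub> g = (\<lambda>i\<in>I. f i \<sqinter>\<^bsub>B i\<^esub> g i)"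
    by (rule P.meet_eqI[OF fg]) (use mj c[OF fg(1)] c[OF fg(2)] c in \<open>simp_all add: carr le\<close>)
  show "f \<squnion>\<^bsub>P\<^esub> g = (\<lambda>i\<in>I. f i \<squnion>\<^bsub>B i\<^esub> g i)"
    by (rule P.join_eqI[OF fg]) (use mj c[OF fg(1)] c[OF fg(2)] c in \<open>simp_all add: carr le\<close>)
qed

lemma hval_product:
  assumes B: "\<And>i. i \<in> I \<Longrightarrow> heyting_algebra (B i)"
    and "\<sigma> ` set_hterm t \<subseteq> carrier (heyting_product I B)"
  shows "hval (heyting_product I B) \<sigma> t \<in> carrier (heyting_product I B) \<and>
         hval (heyting_product I B) \<sigma> t = (\<lambda>i\<in>I. hval (B i) (\<lambda>x. \<sigma> x i) t)"
proof -
  have cl: "(\<lambda>i\<in>I. hval (B i) (\<lambda>x. \<sigma> x i) t) \<in> carrier (heyting_product I B)"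
    if "\<sigma> ` set_hterm t \<subseteq> carrier (heyting_product I B)" for t
    using that B
    by (auto simp: heyting_product_def intro!: heyting_algebra.hval_closed dest!: PiE_mem)
  have "hval (heyting_product I B) \<sigma> t = (\<lambda>i\<in>I. hval (B i) (\<lambda>x. \<sigma> x i) t)"
    using assms(2)
  proof (induction t)
    case (Var x)
    then show ?case
      by (auto simp: heyting_product_def PiE_def extensional_def)
  next
    case (Meet s t)
    then have st: "\<sigma> ` set_hterm s \<subseteq> carrier (heyting_product I B)"
      "\<sigma> ` set_hterm t \<subseteq> carrier (heyting_product I B)"
      by (simp_all add: image_Un)
    show ?case
      unfolding hval.simps Meet.IH(1)[OF st(1)] Meet.IH(2)[OF st(2)]
        heyting_product_ops(3)[OF B cl[OF st(1)] cl[OF st(2)], simplified]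
      by (rule restrict_ext) simp
  next
    case (Join s t)
    then have st: "\<sigma> ` set_hterm s \<subseteq> carrier (heyting_product I B)"
      "\<sigma> ` set_hterm t \<subseteq> carrier (heyting_product I B)"
      by (simp_all add: image_Un)
    show ?case
      unfolding hval.simps Join.IH(1)[OF st(1)] Join.IH(2)[OF st(2)]
        heyting_product_ops(4)[OF B cl[OF st(1)] cl[OF st(2)], simplified]
      by (rule restrict_ext) simp
  qed (auto simp: heyting_product_ops[OF B] image_Un)
  then show ?thesis
    using cl assms(2) by simp
qed

lemma hval_subalgebra:
  assumes "subalgebra S L" "\<sigma> ` set_hterm t \<subseteq> S"
  shows "hval L \<sigma> t \<in> S"
  using assms(2)
proof (induction t)
  case (Meet s t)
  then show ?case using assms(1) by (simp add: subalgebra_def image_Un)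
next
  case (Join s t)
  then show ?case using assms(1) by (simp add: subalgebra_def image_Un)
next
  case (Imp s t)
  then show ?case using assms(1) by (simp add: subalgebra_def image_Un)
qed (use assms(1) in \<open>auto simp: subalgebra_def\<close>)

lemma hval_hom:
  assumes "subalgebra S L" "heyting_hom_on S L M h" "\<sigma> ` set_hterm t \<subseteq> S"
  shows "h (hval L \<sigma> t) = hval M (h \<circ> \<sigma>) t"
  using assms(3)
proof (induction t)
  case (Meet s t)
  then show ?case
    using assms(2) hval_subalgebra[OF assms(1), of \<sigma> s] hval_subalgebra[OF assms(1), of \<sigma> t]
    by (simp add: heyting_hom_on_def image_Un)
next
  case (Join s t)
  then show ?case
    using assms(2) hval_subalgebra[OF assms(1), of \<sigma> s] hval_subalgebra[OF assms(1), of \<sigma> t]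
    by (simp add: heyting_hom_on_def image_Un)
next
  case (Imp s t)
  then show ?case
    using assms(2) hval_subalgebra[OF assms(1), of \<sigma> s] hval_subalgebra[OF assms(1), of \<sigma> t]
    by (simp add: heyting_hom_on_def image_Un)
qed (use assms(2) in \<open>simp_all add: heyting_hom_on_def\<close>)

lemma HSP_imp_variety_generated:
  fixes B :: "'i \<Rightarrow> 'b heyting" and A :: "'a heyting"
  assumes K: "\<And>B. B \<in> K \<Longrightarrow> heyting_algebra B" and A: "heyting_algebra A"
    and B: "\<And>i. i \<in> I \<Longrightarrow> B i \<in> K"
    and S: "subalgebra S (heyting_product I B)"
    and h: "heyting_hom_on S (heyting_product I B) A h" "h ` S = carrier A"
  shows "A \<in> variety_generated K"
proof -
  let ?P = "heyting_product I B"
  have "hval A \<sigma> s = hval A \<sigma> t"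
    if E: "\<forall>B\<in>K. satisfies B E" and st: "(s, t) \<in> E" and \<sigma>: "range \<sigma> \<subseteq> carrier A" for E s t \<sigma>
  proof -
    have "\<forall>n. \<exists>f\<in>S. h f = \<sigma> n"
      using \<sigma> h(2) by (metis image_iff range_subsetD)
    then obtain \<tau> where \<tau>: "\<And>n. \<tau> n \<in> S" "\<And>n. h (\<tau> n) = \<sigma> n" by metis
    have SP: "S \<subseteq> carrier ?P" using S by (simp add: subalgebra_def)
    have ht: "h \<circ> \<tau> = \<sigma>" using \<tau>(2) by auto
    have "hval (B i) (\<lambda>x. \<tau> x i) s = hval (B i) (\<lambda>x. \<tau> x i) t" if "i \<in> I" for i
    proof -
      have "range (\<lambda>x. \<tau> x i) \<subseteq> carrier (B i)"
        using \<tau>(1) SP that by (auto simp: heyting_product_def)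
      then show ?thesis using E B[OF that] st by (fastforce simp: satisfies_def)
    qed
    moreover have "hval ?P \<tau> u = (\<lambda>i\<in>I. hval (B i) (\<lambda>x. \<tau> x i) u)" for u
      using hval_product[of I B \<tau> u] K B \<tau>(1) SP by blast
    ultimately have "hval ?P \<tau> s = hval ?P \<tau> t" by (auto intro!: restrict_ext)
    then show ?thesis
      using hval_hom[OF S h(1), of \<tau>] \<tau>(1) ht by (metis image_subset_iff)
  qed
  then show ?thesis
    using A by (fastforce simp: variety_generated_def satisfies_def)
qed

lemma variety_generated_eq:
  assumes A: "A \<in> variety_generated K" and K: "\<And>B. B \<in> K \<Longrightarrow> heyting_algebra B"
    and st: "set_hterm s \<union> set_hterm t \<subseteq> carrier A"
    and eq: "\<And>B \<sigma>. \<lbrakk>B \<in> K; \<sigma> \<in> carrier A \<rightarrow> carrier B\<rbrakk> \<Longrightarrow> hval B \<sigma> s = hval B \<sigma> t"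
  shows "hval A id s = hval A id t"
proof -
  interpret A: heyting_algebra A using A by (simp add: variety_generated_def)
  let ?V = "set_hterm s \<union> set_hterm t"
  have "finite ?V"
    by (metis finite_Un hterm.set_finite)
  then obtain e :: "_ \<Rightarrow> nat" where e: "inj_on e ?V"
    using finite_imp_inj_to_nat_seg by blast
  define d where "d n = (if n \<in> e ` ?V then inv_into ?V e n else \<bottom>\<^bsub>A\<^esub>)" for n
  have d: "d (e x) = x" if "x \<in> ?V" for x
    using e that by (simp add: d_def)
  have dA: "range d \<subseteq> carrier A"
  proof (rule image_subsetI)
    fix n
    have "inv_into ?V e n \<in> ?V" if "n \<in> e ` ?V" using that by (rule inv_into_into)
    then show "d n \<in> carrier A" using st unfolding d_def by (metis A.bottom_closed subsetD)
  qed
  have "satisfies B {(map_hterm e s, map_hterm e t)}" if B: "B \<in> K" for B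
  proof (clarsimp simp: satisfies_def hval_map)
    fix \<sigma> :: "nat \<Rightarrow> _" assume \<sigma>: "range \<sigma> \<subseteq> carrier B"
    let ?\<tau> = "\<lambda>x. \<sigma> (e x)"
    have "?\<tau> \<in> carrier A \<rightarrow> carrier B"
      using \<sigma> by auto
    then have "hval B ?\<tau> s = hval B ?\<tau> t"
      by (rule eq[OF B])
    then show "hval B (\<sigma> \<circ> e) s = hval B (\<sigma> \<circ> e) t"
      by (simp add: comp_def)
  qed
  then have "satisfies A {(map_hterm e s, map_hterm e t)}"
    using A by (simp add: variety_generated_def)
  then have "hval A d (map_hterm e s) = hval A d (map_hterm e t)"
    using dA by (simp add: satisfies_def)
  moreover have "hval A (d \<circ> e) s = hval A id s" "hval A (d \<circ> e) t = hval A id t"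
    using d by (auto intro!: hval_cong)
  ultimately show ?thesis
    by (simp add: hval_map)
qed

text \<open>
  Products over an index set of the type below suffice; by \<open>HSP_imp_variety_generated\<close>, products
  over any other index type yield nothing more.
\<close>

theorem variety_generated_iff_HSP:
  fixes K :: "'b heyting set" and A :: "'a heyting"
  assumes K: "\<And>B. B \<in> K \<Longrightarrow> heyting_algebra B"
  shows "A \<in> variety_generated K \<longleftrightarrow>
    heyting_algebra A \<and>
    (\<exists>(I :: ('b heyting \<times> ('a \<Rightarrow> 'b)) set) B S h.
       (\<forall>i\<in>I. B i \<in> K) \<and> subalgebra S (heyting_product I B) \<and>
       heyting_hom_on S (heyting_product I B) A h \<and> h ` S = carrier A)"
    (is "?L \<longleftrightarrow> ?R")
proof
  assume ?R
  then show ?L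
    using HSP_imp_variety_generated[OF K] by metis
next
  assume L: ?L
  then interpret A: heyting_algebra A by (simp add: variety_generated_def)
  define I where "I = {(B, \<sigma>). B \<in> K \<and> \<sigma> \<in> carrier A \<rightarrow> carrier B}"
  define T where "T = {t :: 'a hterm. set_hterm t \<subseteq> carrier A}"
  define P where "P = heyting_product I (fst :: 'b heyting \<times> ('a \<Rightarrow> 'b) \<Rightarrow> _)"
  define gen where "gen a = (\<lambda>i\<in>I. snd i a)" for a :: 'a
  define q where "q t = hval P gen t" for t
  have I: "heyting_algebra (fst i)" if "i \<in> I" for i
    using that K by (auto simp: I_def)
  have gen: "gen ` set_hterm t \<subseteq> carrier P" if "t \<in> T" for t
  proof -
    have "snd i a \<in> carrier (fst i)" if "i \<in> I" "a \<in> carrier A" for i a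
      using that by (auto simp: I_def)
    then show ?thesis
      using that by (auto simp: T_def P_def gen_def heyting_product_def)
  qed
  have q: "q t \<in> carrier P" "q t = (\<lambda>i\<in>I. hval (fst i) (snd i) t)" if "t \<in> T" for t
  proof -
    have *: "hval (heyting_product I fst) gen t \<in> carrier (heyting_product I fst) \<and>
         hval (heyting_product I fst) gen t = (\<lambda>i\<in>I. hval (fst i) (\<lambda>x. gen x i) t)"
      by (rule hval_product) (use I gen[OF that] in \<open>auto simp: P_def\<close>)
    then show "q t \<in> carrier P" unfolding q_def P_def by blast
    have "hval (fst i) (\<lambda>x. gen x i) t = hval (fst i) (snd i) t" if "i \<in> I" for i
      using that by (simp add: gen_def)
    then show "q t = (\<lambda>i\<in>I. hval (fst i) (snd i) t)"
      using * by (auto simp: q_def P_def intro!: restrict_ext)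
  qed
  have ker: "hval A id s = hval A id t" if "s \<in> T" "t \<in> T" "q s = q t" for s t
  proof (rule variety_generated_eq[OF L K])
    fix B \<sigma> assume "B \<in> K" "\<sigma> \<in> carrier A \<rightarrow> carrier B"
    then have BI: "(B, \<sigma>) \<in> I" by (simp add: I_def)
    have "q s (B, \<sigma>) = q t (B, \<sigma>)" using that(3) by (rule fun_cong)
    then show "hval B \<sigma> s = hval B \<sigma> t"
      unfolding q(2)[OF that(1)] q(2)[OF that(2)] using BI by simp
  qed (use that in \<open>auto simp: T_def\<close>)
  define h where "h f = hval A id (SOME t. t \<in> T \<and> q t = f)" for f
  have hq: "h (q t) = hval A id t" if "t \<in> T" for t
    unfolding h_def using that by (metis (mono_tags, lifting) ker someI_ex)
  have qops: "\<bottom>\<^bsub>P\<^esub> = q Bot" "\<top>\<^bsub>P\<^esub> = q Top" "q s \<sqinter>\<^bsub>P\<^esub> q t = q (Meet s t)"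
    "q s \<squnion>\<^bsub>P\<^esub> q t = q (Join s t)" "himp P (q s) (q t) = q (Imp s t)" for s t
    by (simp_all add: q_def)
  have T: "Bot \<in> T" "Top \<in> T"
    "\<And>s t. \<lbrakk>s \<in> T; t \<in> T\<rbrakk> \<Longrightarrow> Meet s t \<in> T \<and> Join s t \<in> T \<and> Imp s t \<in> T"
    by (auto simp: T_def)
  have cl: "hval A id t \<in> carrier A" if "t \<in> T" for t
    using that by (intro A.hval_closed) (auto simp: T_def)
  have "subalgebra (q ` T) P"
    unfolding subalgebra_def using q(1) T by (auto simp: qops)
  moreover have "heyting_hom_on (q ` T) P A h"
    unfolding heyting_hom_on_def using T cl by (auto simp: qops hq)
  moreover have "h ` q ` T = carrier A"
  proof
    show "h ` q ` T \<subseteq> carrier A" using cl by (auto simp: hq)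
    show "carrier A \<subseteq> h ` q ` T"
    proof
      fix a assume "a \<in> carrier A"
      then have V: "Var a \<in> T" by (simp add: T_def)
      have "h (q (Var a)) = a" using hq[OF V] by simp
      then show "a \<in> h ` q ` T" using V by (metis imageI)
    qed
  qed
  moreover have "\<forall>i\<in>I. fst i \<in> K" by (auto simp: I_def)
  ultimately show ?R
    using A.heyting_algebra_axioms unfolding P_def
    by (intro conjI exI[of _ I] exI[of _ fst] exI[of _ "q ` T"] exI[of _ h]) simp_all
qed

end

theory Submission
  imports Defs
begin

text \<open>
  Each of the conditions (D1)--(D4) on the sets \<open>up X x\<close> is expressed by an equation that holds in
  \<open>Up X\<close> for every diamond system \<open>X\<close>:
    (D1) by \<open>(c \<rightarrow> a \<or> (a \<rightarrow> b)) \<or> (b \<rightarrow> c)\<close>, (D2) by the bounded width axiom,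
    (D3) by \<open>\<not>a \<or> \<not>\<not>a\<close>, and (D4) by
    \<open>(a \<and> b \<rightarrow> c \<or> d) \<rightarrow> (a \<rightarrow> b \<or> (c \<rightarrow> d) \<or> (d \<rightarrow> c)) \<or> (b \<rightarrow> a)\<close>.
  Conversely, elements of \<open>A\<close> that separate the prime filters of a configuration violating one of the
  conditions refute the corresponding equation; for (D3) and (D4) the prime filter theorem turns the
  absence of a bound into such elements. Hence \<open>up X\<^sub>A F\<close> is a diamond sequence for every prime filter
  \<open>F\<close>.

  A rooted diamond sequence, possibly infinite, is a linear sum of one-point sets and two-element
  antichains. Colour each point with the set of variables true at it. Only finitely many of the
  two-element antichains have points of different colours, and contracting everything else along the
  colours is an order-preserving retraction that is also a p-morphism. Its image is a finite diamond
  sequence, since (D1)--(D4) pass to retracts, and it satisfies the same terms in those variables.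
\<close>

section \<open>Prime filters\<close>

definition lattice_filter :: "('a, 'm) gorder_scheme \<Rightarrow> 'a set \<Rightarrow> bool" where
  "lattice_filter L F \<longleftrightarrow>
     F \<subseteq> carrier L \<and> F \<noteq> {} \<and>
     (\<forall>a\<in>F. \<forall>b\<in>carrier L. a \<sqsubseteq>\<^bsub>L\<^esub> b \<longrightarrow> b \<in> F) \<and>
     (\<forall>a\<in>F. \<forall>b\<in>F. a \<sqinter>\<^bsub>L\<^esub> b \<in> F)"

definition lattice_ideal :: "('a, 'm) gorder_scheme \<Rightarrow> 'a set \<Rightarrow> bool" where
  "lattice_ideal L I \<longleftrightarrow>
     I \<subseteq> carrier L \<and> I \<noteq> {} \<and>
     (\<forall>a\<in>I. \<forall>b\<in>carrier L. b \<sqsubseteq>\<^bsub>L\<^esub> a \<longrightarrow> b \<in> I) \<and>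
     (\<forall>a\<in>I. \<forall>b\<in>I. a \<squnion>\<^bsub>L\<^esub> b \<in> I)"

lemma lattice_filterD:
  assumes "lattice_filter L F"
  shows "F \<subseteq> carrier L" "F \<noteq> {}"
    and "\<lbrakk>a \<in> F; b \<in> carrier L; a \<sqsubseteq>\<^bsub>L\<^esub> b\<rbrakk> \<Longrightarrow> b \<in> F"
    and "\<lbrakk>a \<in> F; b \<in> F\<rbrakk> \<Longrightarrow> a \<sqinter>\<^bsub>L\<^esub> b \<in> F"
  using assms by (simp_all add: lattice_filter_def)

lemma lattice_idealD:
  assumes "lattice_ideal L I"
  shows "I \<subseteq> carrier L" "I \<noteq> {}"
    and "\<lbrakk>a \<in> I; b \<in> carrier L; b \<sqsubseteq>\<^bsub>L\<^esub> a\<rbrakk> \<Longrightarrow> b \<in> I"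
    and "\<lbrakk>a \<in> I; b \<in> I\<rbrakk> \<Longrightarrow> a \<squnion>\<^bsub>L\<^esub> b \<in> I"
  using assms by (simp_all add: lattice_ideal_def)

lemma prime_filterD:
  assumes "prime_filter L P"
  shows "P \<subseteq> carrier L" "P \<noteq> {}" "P \<noteq> carrier L"
    and "\<lbrakk>a \<in> P; b \<in> carrier L; a \<sqsubseteq>\<^bsub>L\<^esub> b\<rbrakk> \<Longrightarrow> b \<in> P"
    and "\<lbrakk>a \<in> P; b \<in> P\<rbrakk> \<Longrightarrow> a \<sqinter>\<^bsub>L\<^esub> b \<in> P"
    and "\<lbrakk>a \<in> carrier L; b \<in> carrier L; a \<squnion>\<^bsub>L\<^esub> b \<in> P\<rbrakk> \<Longrightarrow> a \<in> P \<or> b \<in> P"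
  using assms by (simp_all add: prime_filter_def)

lemma prime_filter_lattice_filter: "prime_filter L P \<Longrightarrow> lattice_filter L P"
  by (simp add: prime_filter_def lattice_filter_def)

section \<open>Separation by prime filters in a Heyting algebra\<close>

context heyting_algebra
begin

lemma meet_mono:
  assumes "a \<in> carrier L" "b \<in> carrier L" "c \<in> carrier L" "d \<in> carrier L" "a \<sqsubseteq> c" "b \<sqsubseteq> d"
  shows "a \<sqinter> b \<sqsubseteq> c \<sqinter> d"
  using assms le_trans[of "a \<sqinter> b" a c] le_trans[of "a \<sqinter> b" b d]
  by (intro meet_le) (simp_all add: meet_left meet_right)

lemma join_mono:
  assumes "a \<in> carrier L" "b \<in> carrier L" "c \<in> carrier L" "d \<in> carrier L" "a \<sqsubseteq> c" "b \<sqsubseteq> d"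
  shows "a \<squnion> b \<sqsubseteq> c \<squnion> d"
  using assms le_trans[of a c "c \<squnion> d"] le_trans[of b d "c \<squnion> d"]
  by (intro join_le) (simp_all add: join_left join_right)

text \<open>The form of distributivity that primeness needs: by residuation \<open>a\<close> and
  \<open>b\<close> both lie below \<open>himp L m i\<close>, hence so does their join.\<close>

lemma meet_join_le:
  assumes "m \<in> carrier L" "a \<in> carrier L" "b \<in> carrier L" "i \<in> carrier L"
    and "m \<sqinter> a \<sqsubseteq> i" "m \<sqinter> b \<sqsubseteq> i"
  shows "m \<sqinter> (a \<squnion> b) \<sqsubseteq> i"
proof -
  have "a \<sqsubseteq> himp L m i" "b \<sqsubseteq> himp L m i"
    using assms himp_residual[of m i a] himp_residual[of m i b] by (simp_all add: meet_comm)
  then have "a \<squnion> b \<sqsubseteq> himp L m i"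
    using assms by (intro join_le) (simp_all add: himp_closed)
  then show ?thesis
    using assms himp_residual[of m i "a \<squnion> b"] by (simp add: meet_comm)
qed

text \<open>The set is the join of \<open>F\<close> and \<open>G\<close> in the lattice of filters.
  It serves both to adjoin an element to a maximal filter and to place a prime filter above two
  given ones.\<close>

lemma lattice_filter_generated:
  assumes F: "lattice_filter L F" and G: "lattice_filter L G"
  shows "lattice_filter L {c \<in> carrier L. \<exists>a\<in>F. \<exists>b\<in>G. a \<sqinter> b \<sqsubseteq> c}"
    and "F \<union> G \<subseteq> {c \<in> carrier L. \<exists>a\<in>F. \<exists>b\<in>G. a \<sqinter> b \<sqsubseteq> c}"
proof -
  have FG: "F \<subseteq> carrier L" "G \<subseteq> carrier L" "F \<noteq> {}" "G \<noteq> {}"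
    using lattice_filterD(1,2)[OF F] lattice_filterD(1,2)[OF G] by simp_all
  have "\<exists>a\<in>F. \<exists>b\<in>G. a \<sqinter> b \<sqsubseteq> c" if "c \<in> F" for c
    using that FG meet_left[of c] by blast
  moreover have "\<exists>a\<in>F. \<exists>b\<in>G. a \<sqinter> b \<sqsubseteq> c" if "c \<in> G" for c
    using that FG meet_right[of _ c] by blast
  ultimately show sub: "F \<union> G \<subseteq> {c \<in> carrier L. \<exists>a\<in>F. \<exists>b\<in>G. a \<sqinter> b \<sqsubseteq> c}"
    using FG by blast
  show "lattice_filter L {c \<in> carrier L. \<exists>a\<in>F. \<exists>b\<in>G. a \<sqinter> b \<sqsubseteq> c}"
    unfolding lattice_filter_def
  proof (intro conjI ballI impI)
    show "{c \<in> carrier L. \<exists>a\<in>F. \<exists>b\<in>G. a \<sqinter> b \<sqsubseteq> c} \<noteq> {}" using sub FG by blast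
    fix c d assume c: "c \<in> {c \<in> carrier L. \<exists>a\<in>F. \<exists>b\<in>G. a \<sqinter> b \<sqsubseteq> c}"
    { assume d: "d \<in> carrier L" "c \<sqsubseteq> d"
      obtain a b where "a \<in> F" "b \<in> G" "a \<sqinter> b \<sqsubseteq> c" using c by blast
      moreover from this have "a \<sqinter> b \<sqsubseteq> d" using c d FG le_trans[of "a \<sqinter> b" c d]
        by (simp add: subset_iff)
      ultimately show "d \<in> {c \<in> carrier L. \<exists>a\<in>F. \<exists>b\<in>G. a \<sqinter> b \<sqsubseteq> c}" using d by blast }
    assume d: "d \<in> {c \<in> carrier L. \<exists>a\<in>F. \<exists>b\<in>G. a \<sqinter> b \<sqsubseteq> c}"
    obtain a b a' b' where ab: "a \<in> F" "b \<in> G" "a' \<in> F" "b' \<in> G" "a \<sqinter> b \<sqsubseteq> c" "a' \<sqinter> b' \<sqsubseteq> d"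
      using c d by blast
    then have cl: "a \<in> carrier L" "b \<in> carrier L" "a' \<in> carrier L" "b' \<in> carrier L"
      using FG by auto
    have "(a \<sqinter> a') \<sqinter> (b \<sqinter> b') \<sqsubseteq> a \<sqinter> b" "(a \<sqinter> a') \<sqinter> (b \<sqinter> b') \<sqsubseteq> a' \<sqinter> b'"
      using cl by (simp_all add: meet_mono meet_left meet_right)
    then have "(a \<sqinter> a') \<sqinter> (b \<sqinter> b') \<sqsubseteq> c \<sqinter> d"
      using ab cl c d le_trans[of "(a \<sqinter> a') \<sqinter> (b \<sqinter> b')" "a \<sqinter> b" c]
        le_trans[of "(a \<sqinter> a') \<sqinter> (b \<sqinter> b')" "a' \<sqinter> b'" d] by (intro meet_le) simp_all
    moreover have "a \<sqinter> a' \<in> F" "b \<sqinter> b' \<in> G"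
      using ab lattice_filterD(4)[OF F] lattice_filterD(4)[OF G] by simp_all
    ultimately show "c \<sqinter> d \<in> {c \<in> carrier L. \<exists>a\<in>F. \<exists>b\<in>G. a \<sqinter> b \<sqsubseteq> c}"
      using c d by auto
  qed auto
qed

text \<open>Order dual of the preceding lemma, used to keep a prime filter disjoint from two ideals
  at once.\<close>

lemma lattice_ideal_generated:
  assumes I: "lattice_ideal L I" and J: "lattice_ideal L J"
  shows "lattice_ideal L {c \<in> carrier L. \<exists>a\<in>I. \<exists>b\<in>J. c \<sqsubseteq> a \<squnion> b}"
    and "I \<union> J \<subseteq> {c \<in> carrier L. \<exists>a\<in>I. \<exists>b\<in>J. c \<sqsubseteq> a \<squnion> b}"
proof -
  have IJ: "I \<subseteq> carrier L" "J \<subseteq> carrier L" "I \<noteq> {}" "J \<noteq> {}"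
    using lattice_idealD(1,2)[OF I] lattice_idealD(1,2)[OF J] by simp_all
  have "\<exists>a\<in>I. \<exists>b\<in>J. c \<sqsubseteq> a \<squnion> b" if "c \<in> I" for c
    using that IJ join_left[of c] by blast
  moreover have "\<exists>a\<in>I. \<exists>b\<in>J. c \<sqsubseteq> a \<squnion> b" if "c \<in> J" for c
    using that IJ join_right[of _ c] by blast
  ultimately show sub: "I \<union> J \<subseteq> {c \<in> carrier L. \<exists>a\<in>I. \<exists>b\<in>J. c \<sqsubseteq> a \<squnion> b}"
    using IJ by blast
  show "lattice_ideal L {c \<in> carrier L. \<exists>a\<in>I. \<exists>b\<in>J. c \<sqsubseteq> a \<squnion> b}"
    unfolding lattice_ideal_def
  proof (intro conjI ballI impI)
    show "{c \<in> carrier L. \<exists>a\<in>I. \<exists>b\<in>J. c \<sqsubseteq> a \<squnion> b} \<noteq> {}" using sub IJ by blast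
    fix c d assume c: "c \<in> {c \<in> carrier L. \<exists>a\<in>I. \<exists>b\<in>J. c \<sqsubseteq> a \<squnion> b}"
    { assume d: "d \<in> carrier L" "d \<sqsubseteq> c"
      obtain a b where "a \<in> I" "b \<in> J" "c \<sqsubseteq> a \<squnion> b" using c by blast
      moreover from this have "d \<sqsubseteq> a \<squnion> b" using c d IJ le_trans[of d c "a \<squnion> b"]
        by (simp add: subset_iff)
      ultimately show "d \<in> {c \<in> carrier L. \<exists>a\<in>I. \<exists>b\<in>J. c \<sqsubseteq> a \<squnion> b}" using d by blast }
    assume d: "d \<in> {c \<in> carrier L. \<exists>a\<in>I. \<exists>b\<in>J. c \<sqsubseteq> a \<squnion> b}"
    obtain a b a' b' where ab: "a \<in> I" "b \<in> J" "a' \<in> I" "b' \<in> J" "c \<sqsubseteq> a \<squnion> b" "d \<sqsubseteq> a' \<squnion> b'"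
      using c d by blast
    then have cl: "a \<in> carrier L" "b \<in> carrier L" "a' \<in> carrier L" "b' \<in> carrier L"
      using IJ by auto
    have "a \<squnion> b \<sqsubseteq> (a \<squnion> a') \<squnion> (b \<squnion> b')" "a' \<squnion> b' \<sqsubseteq> (a \<squnion> a') \<squnion> (b \<squnion> b')"
      using cl by (simp_all add: join_mono join_left join_right)
    then have "c \<squnion> d \<sqsubseteq> (a \<squnion> a') \<squnion> (b \<squnion> b')"
      using ab cl c d le_trans[of c "a \<squnion> b" "(a \<squnion> a') \<squnion> (b \<squnion> b')"]
        le_trans[of d "a' \<squnion> b'" "(a \<squnion> a') \<squnion> (b \<squnion> b')"] by (intro join_le) simp_all
    moreover have "a \<squnion> a' \<in> I" "b \<squnion> b' \<in> J"
      using ab lattice_idealD(4)[OF I] lattice_idealD(4)[OF J] by simp_all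
    ultimately show "c \<squnion> d \<in> {c \<in> carrier L. \<exists>a\<in>I. \<exists>b\<in>J. c \<sqsubseteq> a \<squnion> b}"
      using c d by auto
  qed auto
qed

lemma lattice_filter_principal:
  assumes "a \<in> carrier L"
  shows "lattice_filter L {b \<in> carrier L. a \<sqsubseteq> b}"
  unfolding lattice_filter_def
proof (intro conjI ballI impI)
  show "{b \<in> carrier L. a \<sqsubseteq> b} \<noteq> {}" using assms le_refl by blast
  fix b c assume b: "b \<in> {b \<in> carrier L. a \<sqsubseteq> b}"
  show "c \<in> {b \<in> carrier L. a \<sqsubseteq> b}" if "c \<in> carrier L" "b \<sqsubseteq> c"
    using assms b that le_trans[of a b c] by simp
  show "b \<sqinter> c \<in> {b \<in> carrier L. a \<sqsubseteq> b}" if "c \<in> {b \<in> carrier L. a \<sqsubseteq> b}"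
    using assms b that meet_le[of a b c] by simp
qed blast

text \<open>Zorn's lemma gives a filter \<open>M\<close> that is maximal among those containing
  \<open>F\<close> and missing \<open>I\<close>. It is prime: if neither \<open>a\<close> nor
  \<open>b\<close> lay in \<open>M\<close>, adjoining either one would reach \<open>I\<close>, and
  distributivity would put an element of \<open>I\<close> into \<open>M\<close>.\<close>

theorem prime_filter_theorem:
  assumes F: "lattice_filter L F" and I: "lattice_ideal L I" and FI: "F \<inter> I = {}"
  obtains P where "prime_filter L P" "F \<subseteq> P" "P \<inter> I = {}"
proof -
  let ?\<F> = "{G. lattice_filter L G \<and> F \<subseteq> G \<and> G \<inter> I = {}}"
  have "\<exists>M\<in>?\<F>. \<forall>X\<in>?\<F>. M \<subseteq> X \<longrightarrow> X = M"
  proof (rule subset_Zorn_nonempty)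
    show "?\<F> \<noteq> {}" using F FI by auto
    fix \<C> assume ne: "\<C> \<noteq> {}" and ch: "subset.chain ?\<F> \<C>"
    then have sub: "\<And>G. G \<in> \<C> \<Longrightarrow> lattice_filter L G \<and> F \<subseteq> G \<and> G \<inter> I = {}"
      by (auto simp: subset_chain_def)
    have meet: "a \<sqinter> b \<in> G" if "a \<in> G" "b \<in> G" "G \<in> \<C>" for a b G
      using that sub[OF that(3)] by (simp add: lattice_filter_def)
    have meets: "a \<sqinter> b \<in> \<Union>\<C>" if ab: "a \<in> G" "b \<in> H" "G \<in> \<C>" "H \<in> \<C>" for a b G H
    proof -
      have "G \<subseteq> H \<or> H \<subseteq> G" using ch that by (auto simp: subset_chain_def)
      then show ?thesis using ab meet by (meson UnionI subsetD)
    qed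
    have filt: "G \<subseteq> carrier L" "F \<subseteq> G" "G \<inter> I = {}" if "G \<in> \<C>" for G
      using sub[OF that] by (simp_all add: lattice_filter_def)
    have "\<forall>a\<in>\<Union>\<C>. \<forall>b\<in>\<Union>\<C>. a \<sqinter> b \<in> \<Union>\<C>"
      using meets by (meson UnionE)
    moreover have "\<Union>\<C> \<subseteq> carrier L" "F \<subseteq> \<Union>\<C>" "\<Union>\<C> \<inter> I = {}"
      using ne filt by blast+
    moreover from this have "\<Union>\<C> \<noteq> {}"
      using lattice_filterD(2)[OF F] by blast
    moreover have upward: "b \<in> G" if "a \<in> G" "b \<in> carrier L" "a \<sqsubseteq> b" "G \<in> \<C>" for a b G
      using that sub[OF that(4)] by (simp add: lattice_filter_def)
    moreover have "\<forall>a\<in>\<Union>\<C>. \<forall>b\<in>carrier L. a \<sqsubseteq> b \<longrightarrow> b \<in> \<Union>\<C>"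
      using upward by (meson UnionE UnionI)
    ultimately show "\<Union>\<C> \<in> ?\<F>" unfolding lattice_filter_def by (intro CollectI conjI)
  qed
  then obtain M where M: "M \<in> ?\<F>" and max: "\<forall>X\<in>?\<F>. M \<subseteq> X \<longrightarrow> X = M" ..
  from M have M: "lattice_filter L M" "F \<subseteq> M" "M \<inter> I = {}" by simp_all
  have max: "X = M" if "lattice_filter L X" "M \<subseteq> X" "X \<inter> I = {}" for X
    using max that M(2) by simp
  have MC: "M \<subseteq> carrier L" and IC: "I \<subseteq> carrier L"
    using lattice_filterD(1)[OF M(1)] lattice_idealD(1)[OF I] .
  \<comment> \<open>The filter generated by \<open>M\<close> and \<open>a\<close> is strictly larger
    than \<open>M\<close>, so maximality makes it meet \<open>I\<close>.\<close>
  have meets: "\<exists>m\<in>M. \<exists>i\<in>I. m \<sqinter> a \<sqsubseteq> i" if a: "a \<in> carrier L" "a \<notin> M" for a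
  proof -
    let ?G = "{c \<in> carrier L. \<exists>m\<in>M. \<exists>b\<in>{b \<in> carrier L. a \<sqsubseteq> b}. m \<sqinter> b \<sqsubseteq> c}"
    note G = lattice_filter_generated[OF M(1) lattice_filter_principal[OF a(1)]]
    have "a \<in> ?G" using G(2) a by auto
    then have "?G \<inter> I \<noteq> {}" using max[OF G(1)] G(2) a by auto
    then obtain m b i where "m \<in> M" "b \<in> carrier L" "a \<sqsubseteq> b" "m \<sqinter> b \<sqsubseteq> i" "i \<in> I" by blast
    moreover from this have "m \<sqinter> a \<sqsubseteq> m \<sqinter> b" using MC a by (intro meet_mono) auto
    ultimately have "m \<sqinter> a \<sqsubseteq> i"
      using a MC IC le_trans[of "m \<sqinter> a" "m \<sqinter> b" i] by (simp add: subset_iff)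
    then show ?thesis using \<open>m \<in> M\<close> \<open>i \<in> I\<close> by blast
  qed
  have "a \<in> M \<or> b \<in> M" if ab: "a \<in> carrier L" "b \<in> carrier L" "a \<squnion> b \<in> M" for a b
  proof (rule ccontr)
    assume "\<not> (a \<in> M \<or> b \<in> M)"
    then obtain m n i j where mn: "m \<in> M" "n \<in> M" "i \<in> I" "j \<in> I" "m \<sqinter> a \<sqsubseteq> i" "n \<sqinter> b \<sqsubseteq> j"
      using meets ab by meson
    then have cl: "m \<in> carrier L" "n \<in> carrier L" "i \<in> carrier L" "j \<in> carrier L"
      using MC IC by auto
    have "(m \<sqinter> n) \<sqinter> a \<sqsubseteq> m \<sqinter> a" "(m \<sqinter> n) \<sqinter> b \<sqsubseteq> n \<sqinter> b"
      using cl ab by (simp_all add: meet_mono meet_left meet_right)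
    moreover have "i \<sqsubseteq> i \<squnion> j" "j \<sqsubseteq> i \<squnion> j" using cl by (auto intro: join_left join_right)
    ultimately have "(m \<sqinter> n) \<sqinter> a \<sqsubseteq> i \<squnion> j" "(m \<sqinter> n) \<sqinter> b \<sqsubseteq> i \<squnion> j"
      using mn cl ab le_trans[of "m \<sqinter> a" i "i \<squnion> j"] le_trans[of "n \<sqinter> b" j "i \<squnion> j"]
        le_trans[of "(m \<sqinter> n) \<sqinter> a" "m \<sqinter> a" "i \<squnion> j"]
        le_trans[of "(m \<sqinter> n) \<sqinter> b" "n \<sqinter> b" "i \<squnion> j"]
      by simp_all
    then have "(m \<sqinter> n) \<sqinter> (a \<squnion> b) \<sqsubseteq> i \<squnion> j"
      using cl ab by (intro meet_join_le) auto
    moreover have "(m \<sqinter> n) \<sqinter> (a \<squnion> b) \<in> M"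
      using mn ab lattice_filterD(4)[OF M(1)] by simp
    moreover have "i \<squnion> j \<in> I" using mn lattice_idealD(4)[OF I] by simp
    ultimately have "i \<squnion> j \<in> M \<inter> I"
      using lattice_filterD(3)[OF M(1)] cl by simp
    then show False using M by blast
  qed
  \<comment> \<open>Properness: \<open>M\<close> misses the nonempty set \<open>I\<close>.\<close>
  moreover have "M \<noteq> carrier L"
    using M(3) lattice_idealD(1,2)[OF I] by blast
  ultimately have "prime_filter L M"
    using M(1) unfolding prime_filter_def lattice_filter_def by simp
  then show thesis using that M by blast
qed

text \<open>Separates the join of \<open>F\<close> and \<open>G\<close> from the join of
  \<open>I\<close> and \<open>J\<close>; \<open>none\<close> expresses their disjointness through
  generators. This supplies the bounds demanded by (D3) and (D4).\<close>

lemma prime_filter_between: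
  assumes "lattice_filter L F" "lattice_filter L G" "lattice_ideal L I" "lattice_ideal L J"
    and none: "\<And>a b i j. \<lbrakk>a \<in> F; b \<in> G; i \<in> I; j \<in> J\<rbrakk> \<Longrightarrow> \<not> a \<sqinter> b \<sqsubseteq> i \<squnion> j"
  obtains P where "prime_filter L P" "F \<subseteq> P" "G \<subseteq> P" "P \<inter> I = {}" "P \<inter> J = {}"
proof -
  let ?F = "{c \<in> carrier L. \<exists>a\<in>F. \<exists>b\<in>G. a \<sqinter> b \<sqsubseteq> c}"
  let ?I = "{c \<in> carrier L. \<exists>a\<in>I. \<exists>b\<in>J. c \<sqsubseteq> a \<squnion> b}"
  note F = lattice_filter_generated[OF assms(1,2)] and I = lattice_ideal_generated[OF assms(3,4)]
  have "?F \<inter> ?I = {}"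
  proof (rule ccontr)
    assume "?F \<inter> ?I \<noteq> {}"
    then obtain c a b i j where *: "c \<in> carrier L" "a \<in> F" "b \<in> G" "i \<in> I" "j \<in> J"
      "a \<sqinter> b \<sqsubseteq> c" "c \<sqsubseteq> i \<squnion> j"
      by blast
    then have "a \<in> carrier L" "b \<in> carrier L" "i \<in> carrier L" "j \<in> carrier L"
      using assms(1,2)[THEN lattice_filterD(1)] assms(3,4)[THEN lattice_idealD(1)] by blast+
    then have "a \<sqinter> b \<sqsubseteq> i \<squnion> j" using * le_trans[of "a \<sqinter> b" c "i \<squnion> j"] by simp
    then show False using none * by blast
  qed
  then obtain P where P: "prime_filter L P" "?F \<subseteq> P" "P \<inter> ?I = {}"
    by (rule prime_filter_theorem[OF F(1) I(1)])
  have "F \<union> G \<subseteq> P" by (rule subset_trans[OF F(2) P(2)])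
  moreover have "P \<inter> (I \<union> J) = {}"
    using Int_mono[OF subset_refl I(2), of P] P(3) by simp
  ultimately show thesis
    using P(1) by (intro that[of P]) (simp_all add: Int_Un_distrib)
qed

section \<open>Membership in a prime filter\<close>

lemma prime_filter_top: "prime_filter L P \<Longrightarrow> \<top> \<in> P"
  by (metis ex_in_conv prime_filterD(1,2,4) subsetD top_closed top_higher)

lemma prime_filter_bottom: "prime_filter L P \<Longrightarrow> \<bottom> \<notin> P"
  by (metis bottom_lower prime_filterD(1,3,4) subsetI subset_antisym)

lemma prime_filter_meet:
  "\<lbrakk>prime_filter L P; a \<in> carrier L; b \<in> carrier L\<rbrakk> \<Longrightarrow> a \<sqinter> b \<in> P \<longleftrightarrow> a \<in> P \<and> b \<in> P"
  by (metis meet_left meet_right prime_filterD(4,5))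

lemma prime_filter_join:
  "\<lbrakk>prime_filter L P; a \<in> carrier L; b \<in> carrier L\<rbrakk> \<Longrightarrow> a \<squnion> b \<in> P \<longleftrightarrow> a \<in> P \<or> b \<in> P"
  by (metis join_closed join_left join_right prime_filterD(4,6))

text \<open>How implications are evaluated in the refutations below: an implication in one prime
  filter lies in every larger one, where it can be applied.\<close>

lemma prime_filter_mp:
  assumes P: "prime_filter L P" and "a \<in> P" "b \<in> carrier L" "himp L a b \<in> P"
  shows "b \<in> P"
proof -
  have "a \<in> carrier L" using assms prime_filterD(1)[OF P] by blast
  then have "himp L a b \<sqinter> a \<sqsubseteq> b"
    using himp_residual[of a b "himp L a b"] assms by (simp add: himp_closed)
  moreover have "himp L a b \<sqinter> a \<in> P" using assms prime_filterD(5)[OF P] by simp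
  ultimately show ?thesis using assms prime_filterD(4)[OF P] by metis
qed

text \<open>A filter is disjoint from this ideal just when it is contained in \<open>P\<close>, so
  the ideal encodes an upper bound.\<close>

lemma lattice_ideal_prime_complement:
  assumes P: "prime_filter L P"
  shows "lattice_ideal L (carrier L - P)"
  unfolding lattice_ideal_def
proof (intro conjI ballI impI)
  show "carrier L - P \<noteq> {}" using prime_filterD(1,3)[OF P] by blast
  fix a b assume a: "a \<in> carrier L - P"
  show "b \<in> carrier L - P" if "b \<in> carrier L" "b \<sqsubseteq> a"
    using a that prime_filterD(4)[OF P, of b a] by (metis DiffE DiffI)
  show "a \<squnion> b \<in> carrier L - P" if "b \<in> carrier L - P"
    using a that prime_filter_join[OF P, of a b] by simp
qed blast

text \<open>For a filter, disjointness from this ideal amounts to properness; it is the ideal to use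
  when no upper bound is imposed.\<close>

lemma lattice_ideal_bottom: "lattice_ideal L {\<bottom>}"
  unfolding lattice_ideal_def
  using join_le[of \<bottom> \<bottom> \<bottom>] by (simp add: le_antisym)

end

section \<open>Finite retracts\<close>

lemma three_point_above:
  assumes "three_point_rule X" "x \<in> carrier X" "y \<in> carrier X" "z \<in> carrier X"
    "incomparable X x y" "x \<sqsubseteq>\<^bsub>X\<^esub> z" "x \<noteq> z" "x \<noteq> y"
  shows "y \<sqsubseteq>\<^bsub>X\<^esub> z"
  using assms unfolding three_point_rule_def incomparable_def by blast

text \<open>The rule turned downwards: \<open>y \<sqsubseteq> z\<close> would give
  \<open>y \<sqsubseteq> x\<close>, and if \<open>y\<close> and \<open>z\<close> were incomparable,
  the three point rule applied to \<open>z \<sqsubseteq> x\<close> would give it as well.\<close>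

lemma (in partial_order) three_point_below:
  assumes "three_point_rule L" "x \<in> carrier L" "y \<in> carrier L" "z \<in> carrier L"
    "incomparable L x y" "z \<sqsubseteq> x" "x \<noteq> z"
  shows "z \<sqsubseteq> y"
  using assms unfolding three_point_rule_def incomparable_def
  by (metis le_trans le_refl)

text \<open>Distinct \<open>y\<close> and \<open>z\<close> would be incomparable to each other,
  since the three point rule turns \<open>y \<sqsubseteq> z\<close> into
  \<open>x \<sqsubseteq> z\<close>; together with \<open>x\<close> they would form a 3-element
  antichain.\<close>

lemma (in partial_order) incomparable_unique:
  assumes tp: "three_point_rule L" and width: "\<not> (\<exists>S. antichain L S \<and> card S = 3)"
    and "x \<in> carrier L" "y \<in> carrier L" "z \<in> carrier L"
    and "incomparable L x y" "incomparable L x z"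
  shows "y = z"
proof (rule ccontr)
  assume "y \<noteq> z"
  have "incomparable L y z"
    using assms(3-) tp \<open>y \<noteq> z\<close> unfolding three_point_rule_def incomparable_def
    by (metis le_refl)
  then have "antichain L {x, y, z}"
    using assms(3-) by (auto simp: antichain_def incomparable_def)
  moreover have "card {x, y, z} = 3"
  proof -
    have "x \<noteq> y" "x \<noteq> z" using assms(3-) by (auto simp: incomparable_def)
    then show ?thesis using \<open>y \<noteq> z\<close> by simp
  qed
  ultimately show False using width by blast
qed

text \<open>
  The retraction fixes the points that have an incomparable partner of another colour and contracts
  all remaining points of one colour to a single point.
\<close>

lemma (in partial_order) finite_colour_retraction:
  fixes c :: "'a \<Rightarrow> 'c :: order"
  assumes tp: "three_point_rule L" and width: "\<not> (\<exists>S. antichain L S \<and> card S = 3)"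
    and mono: "\<And>x y. \<lbrakk>x \<in> carrier L; y \<in> carrier L; x \<sqsubseteq> y\<rbrakk> \<Longrightarrow> c x \<le> c y"
    and fin: "finite (c ` carrier L)"
  obtains r where "r \<in> carrier L \<rightarrow> carrier L" "finite (r ` carrier L)"
    and "\<And>x. x \<in> carrier L \<Longrightarrow> r (r x) = r x"
    and "\<And>x. x \<in> carrier L \<Longrightarrow> c (r x) = c x"
    and "\<And>x y. \<lbrakk>x \<in> carrier L; y \<in> carrier L; x \<sqsubseteq> y\<rbrakk> \<Longrightarrow> r x \<sqsubseteq> r y"
    and "\<And>x y. \<lbrakk>x \<in> carrier L; y \<in> carrier L; r x \<sqsubseteq> r y\<rbrakk> \<Longrightarrow> \<exists>z\<in>carrier L. x \<sqsubseteq> z \<and> r z = r y"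
proof -
  define partner where
    "partner x y \<longleftrightarrow> x \<in> carrier L \<and> y \<in> carrier L \<and> incomparable L x y \<and> c x \<noteq> c y" for x y
  define split where "split x \<longleftrightarrow> (\<exists>y. partner x y)" for x
  \<comment> \<open>The choice depends on the colour alone, so all unsplit points of one colour
    share an image. For a colour without unsplit points it is arbitrary.\<close>
  define rep where "rep k = (SOME x. x \<in> carrier L \<and> \<not> split x \<and> c x = k)" for k
  define r where "r x = (if split x then x else rep (c x))" for x
  have partner_sym: "partner y x" if "partner x y" for x y
    using that by (auto simp: partner_def incomparable_def)
  have rep: "rep (c x) \<in> carrier L" "\<not> split (rep (c x))" "c (rep (c x)) = c x"
    if "x \<in> carrier L" "\<not> split x" for x
    using someI[of "\<lambda>y. y \<in> carrier L \<and> \<not> split y \<and> c y = c x" x] that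
    by (simp_all add: rep_def)
  have r_split: "r x = x" if "split x" for x using that by (simp add: r_def)
  have r_closed: "r x \<in> carrier L" and r_c: "c (r x) = c x" and split_r: "split (r x) = split x"
    if "x \<in> carrier L" for x
    using rep[of x] that by (auto simp: r_def)
  have r_eq: "r x = r y" if "\<not> split x" "\<not> split y" "c x = c y" for x y
    using that by (simp add: r_def)
  have r_idem: "r (r x) = r x" if "x \<in> carrier L" for x
    using r_split r_eq split_r[OF that] r_c[OF that] by metis
  \<comment> \<open>A split point cannot lie strictly between two points of equal colour: its
    partner would lie between them too, and monotonicity would give both the same colour.\<close>
  have between: False
    if "partner y p" "x \<in> carrier L" "z \<in> carrier L" "x \<sqsubseteq> y" "x \<noteq> y" "y \<sqsubseteq> z" "y \<noteq> z" "c x = c z" for x y z p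
  proof -
    have "x \<sqsubseteq> p" 
      using that three_point_below[OF tp, of y p x] by (auto simp: partner_def)
    moreover have "p \<sqsubseteq> z"
      using that three_point_above[OF tp, of y p z] by (auto simp: partner_def incomparable_def)
    moreover have "y \<in> carrier L" "p \<in> carrier L" using that by (auto simp: partner_def)
    ultimately have "c x \<le> c y" "c y \<le> c z" "c x \<le> c p" "c p \<le> c z"
      using that(2-7) by (blast intro: mono)+
    then show False using that by (auto simp: partner_def)
  qed
  \<comment> \<open>The only point incomparable to a split point is its partner, which is split as
    well.\<close>
  have split_incomparable: False
    if "split y" "\<not> split z" "z \<in> carrier L" "incomparable L y z" for y z
  proof -
    obtain p where "partner y p" using \<open>split y\<close> split_def by blast
    then have "p = z"
      using that incomparable_unique[OF tp width, of y p z] by (auto simp: partner_def)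
    then show False using that \<open>partner y p\<close> partner_sym by (auto simp: split_def)
  qed
  have same_colour: "c x = c y"
    if "\<not> split x" "x \<in> carrier L" "y \<in> carrier L" "incomparable L x y" for x y
    using that by (auto simp: split_def partner_def)
  have mono_r: "r x \<sqsubseteq> r y" if xy: "x \<in> carrier L" "y \<in> carrier L" "x \<sqsubseteq> y" for x y
  proof (cases "incomparable L (r x) (r y)")
    case True
    \<comment> \<open>Incomparable images cannot occur: split points are fixed by \<open>r\<close>,
      and incomparable unsplit ones have equal colour, hence the same image.\<close>
    have eq: "split x = split y"
      using True split_incomparable[of "r x" "r y"] split_incomparable[of "r y" "r x"] xy
      by (auto simp: split_r r_closed incomparable_def)
    show ?thesis
    proof (cases "split x")
      case True then show ?thesis using eq r_split xy by auto
    next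
      case False
      then have "c x = c y"
        using same_colour[of "r x" "r y"] True xy by (auto simp: split_r r_closed r_c)
      then show ?thesis using r_eq[of x y] False eq xy r_closed by auto
    qed
  next
    case False
    then consider "r x \<sqsubseteq> r y" | "r y \<sqsubseteq> r x" "r x \<noteq> r y"
      using r_closed xy unfolding incomparable_def by force
    then show ?thesis
    proof cases
      case 2
      \<comment> \<open>Images in reverse order force equal colours. As the images differ,
        \<open>x\<close> or \<open>y\<close> is split, and it then lies strictly between two points
        of this colour.\<close>
      have "c x = c y"
        using mono[OF _ _ 2(1)] mono[of x y] xy by (simp add: r_c r_closed)
      then have "split x \<or> split y" using 2 r_eq by blast
      then show ?thesis
      proof
        assume s: "split x"
        then obtain p where p: "partner x p" using split_def by blast
        have "x \<noteq> y" using 2 by auto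
        show ?thesis
          using between[OF p, of "r y" y] p 2 xy \<open>x \<noteq> y\<close> \<open>c x = c y\<close>
          by (auto simp: r_split[OF s] r_closed r_c)
      next
        assume s: "split y"
        then obtain p where p: "partner y p" using split_def by blast
        have "x \<noteq> y" using 2 by auto
        show ?thesis
          using between[OF p, of x "r x"] p 2 xy \<open>x \<noteq> y\<close> \<open>c x = c y\<close>
          by (auto simp: r_split[OF s] r_closed r_c)
      qed
    qed
  qed
  have p_morphism: "\<exists>z\<in>carrier L. x \<sqsubseteq> z \<and> r z = r y"
    if xy: "x \<in> carrier L" "y \<in> carrier L" "r x \<sqsubseteq> r y" for x y
  proof -
    \<comment> \<open>The witness is \<open>r y\<close> in the first case and \<open>x\<close> in
      the second. In the third, \<open>y\<close> would be split and lie strictly between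
      \<open>r x\<close> and \<open>x\<close>, which share its colour.\<close>
    consider "x \<sqsubseteq> r y" | "r x = r y" | "\<not> x \<sqsubseteq> r y" "r x \<noteq> r y" by blast
    then show ?thesis
    proof cases
      case 1 then show ?thesis using xy r_idem r_closed by blast
    next
      case 2 then show ?thesis using xy by blast
    next
      case 3
      then have ns: "\<not> split x" using xy r_split by auto
      have "c x = c y"
      proof (cases "incomparable L x (r y)")
        case True
        then show ?thesis using same_colour[OF ns, of "r y"] xy by (simp add: r_closed r_c)
      next
        case False
        then have "r y \<sqsubseteq> x" using 3 by (auto simp: incomparable_def)
        then show ?thesis
          using mono[OF _ _ xy(3)] mono[of "r y" x] xy by (simp add: r_c r_closed order.antisym)
      qed
      then have s: "split y" using r_eq ns 3 by blast
      then obtain p where p: "partner y p" using split_def by blast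
      have ry: "r y = y" by (rule r_split[OF s])
      have "y \<sqsubseteq> x"
        using split_incomparable[OF s ns] 3 xy unfolding ry incomparable_def by blast
      then have False
        using between[OF p, of "r x" x] xy 3 ns s \<open>c x = c y\<close>
        unfolding ry by (auto simp: r_closed r_c)
      then show ?thesis ..
    qed
  qed
  \<comment> \<open>A split point is determined by its own colour together with that of its
    partner.\<close>
  have fin_split: "finite {x. split x}"
  proof (rule inj_on_finite[where f = "\<lambda>x. (c x, c (SOME p. partner x p))"])
    show "(\<lambda>x. (c x, c (SOME p. partner x p))) ` {x. split x} \<subseteq> c ` carrier L \<times> c ` carrier L"
      using someI_ex[of "partner _"] by (fastforce simp: split_def partner_def)
    show "inj_on (\<lambda>x. (c x, c (SOME p. partner x p))) {x. split x}"
    proof (rule inj_onI, clarsimp)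
      fix x y assume x: "split x" and y: "split y" and c: "c x = c y"
        "c (SOME p. partner x p) = c (SOME p. partner y p)"
      then obtain p q where p: "partner x p" and q: "partner y q" and pq: "c p = c q"
        unfolding split_def by (metis someI_ex)
      have cl: "x \<in> carrier L" "y \<in> carrier L" "p \<in> carrier L" "q \<in> carrier L"
        using p q by (auto simp: partner_def)
      \<comment> \<open>If \<open>x\<close> is strictly below \<open>y\<close>, then
        \<open>p \<sqsubseteq> y\<close> and \<open>x \<sqsubseteq> q\<close>. With equal colour
        pairs this gives \<open>c p \<le> c x\<close> and \<open>c x \<le> c p\<close>, although
        partners differ in colour.\<close>
      have lt: False
        if "partner x p" "partner y q" "c x = c y" "c p = c q" "x \<sqsubseteq> y" "x \<noteq> y" for x y p q
      proof -
        have "p \<sqsubseteq> y"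
          using that three_point_above[OF tp, of x p y] by (auto simp: partner_def incomparable_def)
        moreover have "x \<sqsubseteq> q"
          using that three_point_below[OF tp, of y q x] by (auto simp: partner_def)
        moreover have "x \<in> carrier L" "y \<in> carrier L" "p \<in> carrier L" "q \<in> carrier L"
          using that by (auto simp: partner_def)
        ultimately have "c p \<le> c y" "c x \<le> c q"
          by (blast intro: mono)+
        then show False using that by (auto simp: partner_def)
      qed
      show "x = y"
      proof (cases "incomparable L x y")
        case True
        then have "p = y"
          using incomparable_unique[OF tp width, of x p y] p cl by (auto simp: partner_def)
        then show ?thesis using p c by (auto simp: partner_def)
      next
        case False
        then show ?thesis
          using lt[OF p q] lt[OF q p] c pq by (auto simp: incomparable_def)
      qed
    qed
    show "finite (c ` carrier L \<times> c ` carrier L)" using fin by simp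
  qed
  have "r ` carrier L \<subseteq> {x. split x} \<union> rep ` c ` carrier L"
    by (auto simp: r_def)
  then have "finite (r ` carrier L)"
    using fin_split fin by (meson finite_Un finite_imageI finite_subset)
  then show thesis
    using that[of r] r_closed r_idem r_c mono_r p_morphism by blast
qed

text \<open>The map \<open>g\<close> reflects as well as preserves the order, so it carries
  violations of (D1) and (D2) into \<open>Y\<close>. The elements required by (D3), (D4) and the
  last axiom are found in \<open>Y\<close> and brought back by \<open>f\<close>.\<close>

lemma diamond_sequence_retract:
  assumes "diamond_sequence Y" and X: "partial_order X"
    and f: "f \<in> carrier Y \<rightarrow> carrier X" "g \<in> carrier X \<rightarrow> carrier Y"
      "\<And>x. x \<in> carrier X \<Longrightarrow> f (g x) = x"
    and fm: "\<And>x y. \<lbrakk>x \<in> carrier Y; y \<in> carrier Y; x \<sqsubseteq>\<^bsub>Y\<^esub> y\<rbrakk> \<Longrightarrow> f x \<sqsubseteq>\<^bsub>X\<^esub> f y"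
    and gm: "\<And>x y. \<lbrakk>x \<in> carrier X; y \<in> carrier X; x \<sqsubseteq>\<^bsub>X\<^esub> y\<rbrakk> \<Longrightarrow> g x \<sqsubseteq>\<^bsub>Y\<^esub> g y"
  shows "diamond_sequence X"
proof -
  interpret Y: diamond_sequence Y by fact
  interpret X: partial_order X by fact
  have g: "g x \<in> carrier Y" if "x \<in> carrier X" for x using f that by auto
  have f': "f x \<in> carrier X" if "x \<in> carrier Y" for x using f that by auto
  have iff: "g x \<sqsubseteq>\<^bsub>Y\<^esub> g y \<longleftrightarrow> x \<sqsubseteq>\<^bsub>X\<^esub> y" if "x \<in> carrier X" "y \<in> carrier X" for x y
    using that fm[of "g x" "g y"] gm[of x y] g f(3) by metis
  have inj: "g x = g y \<longleftrightarrow> x = y" if "x \<in> carrier X" "y \<in> carrier X" for x y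
    using that f(3) by metis
  have inc: "incomparable Y (g x) (g y) \<longleftrightarrow> incomparable X x y"
    if "x \<in> carrier X" "y \<in> carrier X" for x y
    using that by (simp add: incomparable_def iff)
  have fl: "f y \<sqsubseteq>\<^bsub>X\<^esub> x" if "y \<sqsubseteq>\<^bsub>Y\<^esub> g x" "x \<in> carrier X" "y \<in> carrier Y" for x y
    using fm[OF _ _ that(1)] that g f(3) by metis
  have fu: "x \<sqsubseteq>\<^bsub>X\<^esub> f y" if "g x \<sqsubseteq>\<^bsub>Y\<^esub> y" "x \<in> carrier X" "y \<in> carrier Y" for x y
    using fm[OF _ _ that(1)] that g f(3) by metis
  show ?thesis
  proof unfold_locales
    fix x assume x: "x \<in> carrier X"
    show "three_point_rule (X\<lparr>carrier := up X x\<rparr>)"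
      unfolding three_point_rule_def
    proof (intro ballI impI)
      fix u v w
      assume *: "u \<in> carrier (X\<lparr>carrier := up X x\<rparr>)" "v \<in> carrier (X\<lparr>carrier := up X x\<rparr>)"
        "w \<in> carrier (X\<lparr>carrier := up X x\<rparr>)" "u \<noteq> v \<and> u \<noteq> w \<and> v \<noteq> w"
        "incomparable (X\<lparr>carrier := up X x\<rparr>) u v" "u \<sqsubseteq>\<^bsub>X\<lparr>carrier := up X x\<rparr>\<^esub> w"
      then have c: "u \<in> carrier X" "v \<in> carrier X" "w \<in> carrier X" by (auto simp: up_def)
      have i: "incomparable Y (g u) (g v)"
        using * c inc by (simp add: incomparable_def)
      have "g v \<sqsubseteq>\<^bsub>Y\<^esub> g w"
        using three_point_above[OF Y.D1[OF g[OF x]], of "g u" "g v" "g w"] i * c x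
        by (simp add: incomparable_def up_def g inj iff)
      then show "v \<sqsubseteq>\<^bsub>X\<lparr>carrier := up X x\<rparr>\<^esub> w" using c iff by simp
    qed
    show "\<not> (\<exists>S\<subseteq>up X x. antichain X S \<and> card S = 3)"
    proof clarify
      fix S assume S: "S \<subseteq> up X x" "antichain X S" "card S = 3"
      then have SX: "S \<subseteq> carrier X" by (auto simp: antichain_def)
      have "inj_on g S" by (rule inj_onI) (use SX inj in blast)
      then have "card (g ` S) = 3" using S by (simp add: card_image)
      moreover have "g ` S \<subseteq> up Y (g x)" using S x by (auto simp: up_def g iff)
      moreover have "antichain Y (g ` S)"
        using S SX g unfolding antichain_def by (auto simp: inc subset_iff)
      ultimately show False using Y.D2[OF g[OF x]] by blast
    qed
    fix y z assume "y \<in> up X x" "z \<in> up X x"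
    then have c: "y \<in> carrier X" "z \<in> carrier X" "g y \<in> up Y (g x)" "g z \<in> up Y (g x)"
      using x by (auto simp: up_def g iff)
    obtain w where "w \<in> carrier Y" "g y \<sqsubseteq>\<^bsub>Y\<^esub> w" "g z \<sqsubseteq>\<^bsub>Y\<^esub> w"
      using Y.D3[OF g[OF x] c(3,4)] by metis
    then show "\<exists>w\<in>carrier X. y \<sqsubseteq>\<^bsub>X\<^esub> w \<and> z \<sqsubseteq>\<^bsub>X\<^esub> w"
      using fu c f' by (intro bexI[of _ "f w"] conjI) simp_all
  next
    fix b x y z v t
    assume c: "b \<in> carrier X" "x \<in> carrier X" "y \<in> carrier X" "z \<in> carrier X" "v \<in> carrier X"
      "t \<in> carrier X"
      and "b \<sqsubseteq>\<^bsub>X\<^esub> x" "b \<sqsubseteq>\<^bsub>X\<^esub> y" "x \<sqsubseteq>\<^bsub>X\<^esub> z" "x \<sqsubseteq>\<^bsub>X\<^esub> v" "y \<sqsubseteq>\<^bsub>X\<^esub> z" "y \<sqsubseteq>\<^bsub>X\<^esub> v"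
        "z \<sqsubseteq>\<^bsub>X\<^esub> t" "v \<sqsubseteq>\<^bsub>X\<^esub> t"
    then obtain w where "w \<in> carrier Y" "g x \<sqsubseteq>\<^bsub>Y\<^esub> w" "g y \<sqsubseteq>\<^bsub>Y\<^esub> w" "w \<sqsubseteq>\<^bsub>Y\<^esub> g z" "w \<sqsubseteq>\<^bsub>Y\<^esub> g v"
      using Y.D4[of "g b" "g x" "g y" "g z" "g v" "g t"] by (auto simp: g iff)
    then show "\<exists>w\<in>carrier X. x \<sqsubseteq>\<^bsub>X\<^esub> w \<and> y \<sqsubseteq>\<^bsub>X\<^esub> w \<and> w \<sqsubseteq>\<^bsub>X\<^esub> z \<and> w \<sqsubseteq>\<^bsub>X\<^esub> v"
      using fu fl c f' by (intro bexI[of _ "f w"] conjI) simp_all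
  next
    fix x y assume c: "x \<in> carrier X" "y \<in> carrier X"
    then obtain w where "w \<in> carrier Y" "w \<sqsubseteq>\<^bsub>Y\<^esub> g x" "w \<sqsubseteq>\<^bsub>Y\<^esub> g y"
      using Y.common_lower_bound[OF g g] by metis
    then show "\<exists>w\<in>carrier X. w \<sqsubseteq>\<^bsub>X\<^esub> x \<and> w \<sqsubseteq>\<^bsub>X\<^esub> y"
      using fl c f' by (intro bexI[of _ "f w"] conjI) simp_all
  qed
qed

section \<open>Terms valid in diamond systems\<close>

text \<open>Kripke forcing for intuitionistic logic. By \<open>mem_hval_Up_iff\<close> it describes
  the value of a term in \<open>Up X\<close> point by point.\<close>

primrec forces :: "('a, 'm) gorder_scheme \<Rightarrow> ('v \<Rightarrow> 'a set) \<Rightarrow> 'a \<Rightarrow> 'v hterm \<Rightarrow> bool" where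
  "forces X \<tau> x (Var n) \<longleftrightarrow> x \<in> \<tau> n"
| "forces X \<tau> x Bot \<longleftrightarrow> False"
| "forces X \<tau> x Top \<longleftrightarrow> True"
| "forces X \<tau> x (Meet s t) \<longleftrightarrow> forces X \<tau> x s \<and> forces X \<tau> x t"
| "forces X \<tau> x (Join s t) \<longleftrightarrow> forces X \<tau> x s \<or> forces X \<tau> x t"
| "forces X \<tau> x (Imp s t) \<longleftrightarrow> (\<forall>y\<in>up X x. forces X \<tau> y s \<longrightarrow> forces X \<tau> y t)"

lemma upset_hval:
  assumes "partial_order X" "\<And>v. v \<in> set_hterm t \<Longrightarrow> upset X (\<tau> v)"
  shows "upset X (hval (Up X) \<tau> t)"
  using heyting_algebra.hval_closed[OF heyting_algebra_Up[OF assms(1)], of \<tau> t] assms(2)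
  by (auto simp: Up_def)

lemma mem_hval_Up_iff:
  assumes X: "partial_order X" and "\<And>v. v \<in> set_hterm t \<Longrightarrow> upset X (\<tau> v)" and "x \<in> carrier X"
  shows "x \<in> hval (Up X) \<tau> t \<longleftrightarrow> forces X \<tau> x t"
  using assms(2,3)
proof (induction t arbitrary: x)
  case Bot then show ?case by (simp add: Up_bottom)
next
  case Top then show ?case by (simp add: Up_top)
next
  case (Meet s t)
  then show ?case using Up_meet[OF upset_hval[OF X, of s \<tau>] upset_hval[OF X, of t \<tau>]] by simp
next
  case (Join s t)
  then show ?case using Up_join[OF upset_hval[OF X, of s \<tau>] upset_hval[OF X, of t \<tau>]] by simp
next
  case (Imp s t)
  have "y \<in> carrier X" if "y \<in> up X x" for y using that by (simp add: up_def)
  then have IH: "y \<in> hval (Up X) \<tau> s \<longleftrightarrow> forces X \<tau> y s" "y \<in> hval (Up X) \<tau> t \<longleftrightarrow> forces X \<tau> y t"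
    if "y \<in> up X x" for y
    using Imp that by auto
  have "x \<in> hval (Up X) \<tau> (Imp s t) \<longleftrightarrow> up X x \<inter> hval (Up X) \<tau> s \<subseteq> hval (Up X) \<tau> t"
    using Imp.prems(2) by (simp add: Up_def)
  then show ?case using IH by auto
qed simp

text \<open>Monotonicity and lifting make \<open>up Y (f x)\<close> the image of
  \<open>up X x\<close>, which settles implication. The lemma serves both for the retraction onto a
  finite poset and for the inclusion of an upset.\<close>

lemma forces_p_morphism:
  assumes f: "\<And>x. x \<in> carrier X \<Longrightarrow> f x \<in> carrier Y"
    and mono: "\<And>x y. \<lbrakk>x \<in> carrier X; y \<in> up X x\<rbrakk> \<Longrightarrow> f y \<in> up Y (f x)"
    and lift: "\<And>x y. \<lbrakk>x \<in> carrier X; y \<in> up Y (f x)\<rbrakk> \<Longrightarrow> \<exists>z\<in>up X x. f z = y"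
    and "\<And>v x. \<lbrakk>v \<in> set_hterm t; x \<in> carrier X\<rbrakk> \<Longrightarrow> x \<in> \<sigma> v \<longleftrightarrow> f x \<in> \<tau> v" and "x \<in> carrier X"
  shows "forces X \<sigma> x t \<longleftrightarrow> forces Y \<tau> (f x) t"
  using assms(4,5)
proof (induction t arbitrary: x)
  case (Imp s t)
  have "y \<in> carrier X" if "y \<in> up X x" for y using that by (simp add: up_def)
  then have IH: "forces X \<sigma> y s \<longleftrightarrow> forces Y \<tau> (f y) s" "forces X \<sigma> y t \<longleftrightarrow> forces Y \<tau> (f y) t"
    if "y \<in> up X x" for y
    using Imp that by auto
  have "up Y (f x) = f ` up X x"
    using mono lift Imp.prems(2) by blast
  then show ?case using IH by auto
qed auto

lemma (in diamond_system) three_point_rooted: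
  assumes "r \<in> carrier X" "x \<in> up X r" "y \<in> up X r" "z \<in> up X r"
    "incomparable X x y" "x \<sqsubseteq> z" "x \<noteq> z"
  shows "y \<sqsubseteq> z"
proof -
  have "x \<noteq> y" using assms by (auto simp: incomparable_def up_def)
  then show ?thesis
    using three_point_above[OF D1[OF assms(1)], of x y z] assms
    by (simp add: incomparable_def)
qed

lemma up_trans:
  assumes "partial_order X" "x \<in> carrier X" "y \<in> up X x" "z \<in> up X y"
  shows "z \<in> up X x"
proof -
  interpret partial_order X by fact
  show ?thesis using assms le_trans[of x y z] by (simp add: up_def)
qed

lemma upset_memD: "\<lbrakk>upset X U; x \<in> U; y \<in> carrier X; x \<sqsubseteq>\<^bsub>X\<^esub> y\<rbrakk> \<Longrightarrow> y \<in> U"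
  unfolding upset_def up_def by blast

section \<open>Soundness of the terms expressing (D1) to (D4)\<close>

context diamond_system
begin

lemma up_up: "\<lbrakk>x \<in> carrier X; y \<in> up X x; z \<in> up X y\<rbrakk> \<Longrightarrow> z \<in> up X x"
  by (rule up_trans[OF partial_order_axioms])

text \<open>A refutation yields incomparable \<open>y\<close> and \<open>z\<close> and a point
  \<open>u\<close> strictly above \<open>y\<close> but not above \<open>z\<close>: \<open>c\<close>
  separates \<open>y\<close> from \<open>z\<close>, \<open>b\<close> separates \<open>z\<close> from
  \<open>u\<close>, and \<open>a\<close> separates \<open>u\<close> from \<open>y\<close>.\<close>

lemma forces_three_point:
  assumes U: "\<And>n. upset X (\<tau> n)" and x: "x \<in> carrier X"
  shows "forces X \<tau> x
    (Join (Imp (Var c) (Join (Var a) (Imp (Var a) (Var b)))) (Imp (Var b) (Var c)))"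
proof (rule ccontr)
  assume "\<not> ?thesis"
  then obtain y u z where y: "y \<in> up X x" "y \<in> \<tau> c" "y \<notin> \<tau> a"
    and u: "u \<in> up X y" "u \<in> \<tau> a" "u \<notin> \<tau> b" and z: "z \<in> up X x" "z \<in> \<tau> b" "z \<notin> \<tau> c"
    by auto
  have cl: "y \<in> carrier X" "u \<in> carrier X" "z \<in> carrier X" and yu: "y \<sqsubseteq> u"
    using y u z by (simp_all add: up_def)
  have ux: "u \<in> up X x" using up_up[OF x y(1) u(1)] .
  have "\<not> y \<sqsubseteq> z" using upset_memD[OF U y(2) cl(3)] z by metis
  moreover have zu: "\<not> z \<sqsubseteq> u" using upset_memD[OF U z(2) cl(2)] u by metis
  moreover have "\<not> z \<sqsubseteq> y" using zu yu le_trans[OF _ yu cl(3,1,2)] by metis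
  ultimately have "incomparable X y z" by (simp add: incomparable_def)
  moreover have "y \<noteq> u" using y u by metis
  ultimately show False using three_point_rooted[OF x y(1) z(1) ux _ yu] zu by metis
qed

text \<open>If all three disjuncts fail, there are three points above \<open>x\<close> each lying in
  just one of the three upsets; these form an antichain.\<close>

lemma forces_width:
  assumes U: "\<And>n. upset X (\<tau> n)" and x: "x \<in> carrier X"
  shows "forces X \<tau> x
    (Join (Imp (Var a) (Join (Var b) (Var c)))
      (Join (Imp (Var b) (Join (Var a) (Var c))) (Imp (Var c) (Join (Var a) (Var b)))))"
proof (rule ccontr)
  assume "\<not> ?thesis"
  then obtain y u z where y: "y \<in> up X x" "y \<in> \<tau> a" "y \<notin> \<tau> b" "y \<notin> \<tau> c"
    and u: "u \<in> up X x" "u \<in> \<tau> b" "u \<notin> \<tau> a" "u \<notin> \<tau> c"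
    and z: "z \<in> up X x" "z \<in> \<tau> c" "z \<notin> \<tau> a" "z \<notin> \<tau> b"
    by auto
  have cl: "y \<in> carrier X" "u \<in> carrier X" "z \<in> carrier X"
    using y u z by (simp_all add: up_def)
  have "incomparable X y u" "incomparable X y z" "incomparable X u z"
    using upset_memD[OF U] y u z cl unfolding incomparable_def by metis+
  then have "antichain X {y, u, z}"
    using cl by (simp add: antichain_def incomparable_def)
  moreover have "y \<noteq> u" "y \<noteq> z" "u \<noteq> z" using y u z by metis+
  then have "card {y, u, z} = 3" by simp
  moreover have "{y, u, z} \<subseteq> up X x" using y u z by simp
  ultimately show False using D2[OF x] by metis
qed

text \<open>If both disjuncts fail, some \<open>y\<close> above \<open>x\<close> lies in
  \<open>\<tau> a\<close> and some \<open>z\<close> above \<open>x\<close> has nothing of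
  \<open>\<tau> a\<close> above it; a common upper bound of the two is contradictory.\<close>

lemma forces_weak_excluded_middle:
  assumes U: "\<And>n. upset X (\<tau> n)" and x: "x \<in> carrier X"
  shows "forces X \<tau> x (Join (Imp (Var a) Bot) (Imp (Imp (Var a) Bot) Bot))"
proof (rule ccontr)
  assume "\<not> ?thesis"
  then obtain y z where y: "y \<in> up X x" "y \<in> \<tau> a" and z: "z \<in> up X x" "\<forall>u\<in>up X z. u \<notin> \<tau> a"
    by auto
  obtain w where w: "w \<in> carrier X" "y \<sqsubseteq> w" "z \<sqsubseteq> w" using D3[OF x y(1) z(1)] by metis
  then have "w \<in> up X z" by (simp add: up_def)
  moreover have "w \<in> \<tau> a" by (rule upset_memD[OF U y(2) w(1,2)])
  ultimately show False using z by metis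
qed

text \<open>A refutation gives incomparable \<open>y\<close>, \<open>u\<close> above a root
  \<open>r\<close>, and \<open>z\<close>, \<open>v\<close> above \<open>y\<close>. The three point
  rule puts \<open>z\<close> and \<open>v\<close> above \<open>u\<close> too, and (D3) supplies the
  top point for (D4). The interpolant \<open>w\<close> then violates the premise: \<open>c\<close>
  at \<open>w\<close> would persist to \<open>v\<close>, and \<open>d\<close> to
  \<open>z\<close>.\<close>

lemma forces_interpolation:
  assumes U: "\<And>n. upset X (\<tau> n)" and x: "x \<in> carrier X"
  shows "forces X \<tau> x
    (Imp (Imp (Meet (Var a) (Var b)) (Join (Var c) (Var d)))
      (Join (Imp (Var a) (Join (Var b) (Join (Imp (Var c) (Var d)) (Imp (Var d) (Var c)))))
        (Imp (Var b) (Var a))))"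
proof (rule ccontr)
  assume "\<not> ?thesis"
  then obtain r y u z v where r: "r \<in> up X x" "\<forall>w\<in>up X r. w \<in> \<tau> a \<and> w \<in> \<tau> b \<longrightarrow> w \<in> \<tau> c \<or> w \<in> \<tau> d"
    and y: "y \<in> up X r" "y \<in> \<tau> a" "y \<notin> \<tau> b"
    and u: "u \<in> up X r" "u \<in> \<tau> b" "u \<notin> \<tau> a"
    and z: "z \<in> up X y" "z \<in> \<tau> c" "z \<notin> \<tau> d" and v: "v \<in> up X y" "v \<in> \<tau> d" "v \<notin> \<tau> c"
    by auto
  have rX: "r \<in> carrier X" using r by (simp add: up_def)
  have cl: "y \<in> carrier X" "u \<in> carrier X" "z \<in> carrier X" "v \<in> carrier X"
    and le: "r \<sqsubseteq> y" "r \<sqsubseteq> u" "y \<sqsubseteq> z" "y \<sqsubseteq> v"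
    using y u z v by (simp_all add: up_def)
  note zr = up_up[OF rX y(1) z(1)] and vr = up_up[OF rX y(1) v(1)]
  have yu: "incomparable X y u"
    using upset_memD[OF U] y u cl unfolding incomparable_def by metis
  have "y \<noteq> v" using upset_memD[OF U v(2) cl(3)] le z by metis
  then have uv: "u \<sqsubseteq> v" using three_point_rooted[OF rX y(1) u(1) vr yu le(4)] by metis
  have "y \<noteq> z" using upset_memD[OF U z(2) cl(4)] le v by metis
  then have uz: "u \<sqsubseteq> z" using three_point_rooted[OF rX y(1) u(1) zr yu le(3)] by metis
  obtain t where t: "t \<in> carrier X" "z \<sqsubseteq> t" "v \<sqsubseteq> t" using D3[OF rX zr vr] by metis
  obtain w where w: "w \<in> carrier X" "y \<sqsubseteq> w" "u \<sqsubseteq> w" "w \<sqsubseteq> z" "w \<sqsubseteq> v"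
    using D4[OF rX cl t(1) le uz uv t(2,3)] by metis
  have "w \<in> \<tau> a" "w \<in> \<tau> b"
    by (rule upset_memD[OF U y(2) w(1,2)], rule upset_memD[OF U u(2) w(1,3)])
  moreover have "w \<in> up X r"
    using w le_trans[OF le(1) w(2) rX cl(1) w(1)] by (simp add: up_def)
  ultimately have "w \<in> \<tau> c \<or> w \<in> \<tau> d" using r(2) by metis
  then show False
    using upset_memD[OF U _ cl(4) w(5)] upset_memD[OF U _ cl(3) w(4)] z v by metis
qed

end

text \<open>The bridge from \<open>DHA\<close> to forcing: validity of \<open>t\<close> makes
  \<open>t = Top\<close> an equation of all generators, which therefore passes to \<open>A\<close>.
  Posets on \<open>nat\<close> are considered because the generators live there.\<close>

lemma DHA_valid:
  fixes A :: "'a heyting" and t :: "nat hterm"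
  assumes A: "A \<in> DHA" and \<sigma>: "range \<sigma> \<subseteq> carrier A"
    and valid: "\<And>(X :: nat gorder) \<tau> x.
      \<lbrakk>diamond_system X; \<And>n. upset X (\<tau> n); x \<in> carrier X\<rbrakk> \<Longrightarrow> forces X \<tau> x t"
  shows "hval A \<sigma> t = \<top>\<^bsub>A\<^esub>"
proof -
  have "satisfies (Up X) {(t, Top)}"
    if "diamond_sequence X" for X :: "nat gorder"
  proof -
    interpret diamond_sequence X by fact
    have "hval (Up X) \<tau> t = carrier X" if "range \<tau> \<subseteq> carrier (Up X)" for \<tau>
    proof -
      have U: "\<And>n. upset X (\<tau> n)" using that by (auto simp: Up_def)
      have "hval (Up X) \<tau> t \<subseteq> carrier X"
        using upset_hval[OF partial_order_axioms, of t \<tau>] U by (simp add: upset_def)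
      moreover have "x \<in> hval (Up X) \<tau> t" if "x \<in> carrier X" for x
        using mem_hval_Up_iff[of X t \<tau> x, OF partial_order_axioms U that]
          valid[of X \<tau>, OF diamond_system_axioms U that] by simp
      ultimately show ?thesis by (intro subset_antisym subsetI) auto
    qed
    then show ?thesis by (simp add: satisfies_def Up_top)
  qed
  then have "satisfies A {(t, Top)}"
    using A by (auto simp: DHA_def variety_generated_def)
  then show ?thesis using \<sigma> by (simp add: satisfies_def)
qed

section \<open>Prime spectra of algebras in DHA\<close>

lemma prime_filter_not_subsetE:
  assumes "prime_filter A P" "\<not> P \<subseteq> Q"
  obtains a where "a \<in> carrier A" "a \<in> P" "a \<notin> Q"
  using assms prime_filterD(1) by blast

context
  fixes A :: "'a heyting"
  assumes A: "A \<in> DHA"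
begin

interpretation heyting_algebra A
  using A by (simp add: DHA_def variety_generated_def)

lemma DHA_hval_in_prime_filter:
  fixes t :: "nat hterm"
  assumes "prime_filter A P" "range \<sigma> \<subseteq> carrier A"
    and "\<And>(X :: nat gorder) \<tau> x.
      \<lbrakk>diamond_system X; \<And>n. upset X (\<tau> n); x \<in> carrier X\<rbrakk> \<Longrightarrow> forces X \<tau> x t"
  shows "hval A \<sigma> t \<in> P"
proof -
  have "hval A \<sigma> t = \<top>\<^bsub>A\<^esub>" by (rule DHA_valid[OF A assms(2,3)])
  then show ?thesis using prime_filter_top[OF assms(1)] by simp
qed

text \<open>\<open>Q\<close>, \<open>S\<close>, \<open>R\<close> play the parts of \<open>y\<close>,
  \<open>u\<close>, \<open>z\<close> in \<open>forces_three_point\<close>; a violation of the rule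
  provides the elements that separate them.\<close>

lemma prime_three_point:
  assumes p: "prime_filter A P" "prime_filter A Q" "prime_filter A R" "prime_filter A S"
    and sub: "P \<subseteq> Q" "P \<subseteq> R" and QS: "Q \<subseteq> S" "Q \<noteq> S" and RQ: "\<not> Q \<subseteq> R"
  shows "R \<subseteq> S"
proof (rule ccontr)
  assume "\<not> R \<subseteq> S"
  then obtain b where b: "b \<in> carrier A" "b \<in> R" "b \<notin> S"
    using prime_filter_not_subsetE p(3) by metis
  obtain a where a: "a \<in> carrier A" "a \<in> S" "a \<notin> Q"
    using prime_filter_not_subsetE[OF p(4)] QS by (metis subset_antisym)
  obtain c where c: "c \<in> carrier A" "c \<in> Q" "c \<notin> R"
    using prime_filter_not_subsetE[OF p(2) RQ] by metis
  define \<sigma> :: "nat \<Rightarrow> 'a" where "\<sigma> n = (if n = 0 then a else if n = 1 then b else c)" for n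
  have "range \<sigma> \<subseteq> carrier A" using a b c by (simp add: \<sigma>_def image_subset_iff)
  \<comment> \<open>Variables 0, 1, 2 denote \<open>a\<close>, \<open>b\<close>, \<open>c\<close>;
    the instantiation \<open>2 0 1\<close> follows the order \<open>c\<close>, \<open>a\<close>,
    \<open>b\<close> of the term.\<close>
  from DHA_hval_in_prime_filter[OF p(1) this diamond_system.forces_three_point, of 2 0 1]
  have "himp A c (a \<squnion>\<^bsub>A\<^esub> himp A a b) \<squnion>\<^bsub>A\<^esub> himp A b c \<in> P"
    by (simp add: \<sigma>_def)
  then consider "himp A c (a \<squnion>\<^bsub>A\<^esub> himp A a b) \<in> P" | "himp A b c \<in> P"
    using prime_filter_join[OF p(1)] a b c by (auto simp: himp_closed)
  then show False
  proof cases
    case 1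
    then have "a \<squnion>\<^bsub>A\<^esub> himp A a b \<in> Q"
      using prime_filter_mp[OF p(2) c(2)] sub a b by (simp add: himp_closed subsetD)
    then have "himp A a b \<in> S"
      using prime_filter_join[OF p(2), of a] a b QS by (auto simp: himp_closed)
    then show False using prime_filter_mp[OF p(4) a(2)] b by simp
  next
    case 2
    then show False using prime_filter_mp[OF p(3) b(2) c(1)] sub c by (simp add: subsetD)
  qed
qed

lemma prime_width:
  assumes p: "prime_filter A P" "prime_filter A Q" "prime_filter A R" "prime_filter A S"
    and sub: "P \<subseteq> Q" "P \<subseteq> R" "P \<subseteq> S"
  shows "Q \<subseteq> R \<or> R \<subseteq> Q \<or> Q \<subseteq> S \<or> S \<subseteq> Q \<or> R \<subseteq> S \<or> S \<subseteq> R"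
proof (rule ccontr)
  assume "\<not> ?thesis"
  then have n: "\<not> Q \<subseteq> R" "\<not> Q \<subseteq> S" "\<not> R \<subseteq> Q" "\<not> R \<subseteq> S" "\<not> S \<subseteq> Q" "\<not> S \<subseteq> R" by simp_all
  \<comment> \<open>The meet of one element separating \<open>F\<close> from \<open>G\<close> and
    one separating \<open>F\<close> from \<open>H\<close> avoids both.\<close>
  have ex: "\<exists>a\<in>carrier A. a \<in> F \<and> a \<notin> G \<and> a \<notin> H"
    if F: "prime_filter A F" and GH: "prime_filter A G" "prime_filter A H" "\<not> F \<subseteq> G" "\<not> F \<subseteq> H" for F G H
  proof -
    obtain g where g: "g \<in> carrier A" "g \<in> F" "g \<notin> G" by (rule prime_filter_not_subsetE[OF F GH(3)])
    obtain h where h: "h \<in> carrier A" "h \<in> F" "h \<notin> H" by (rule prime_filter_not_subsetE[OF F GH(4)])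
    show ?thesis
      using prime_filter_meet[OF _ g(1) h(1)] F GH(1,2) g h by (intro bexI[of _ "g \<sqinter>\<^bsub>A\<^esub> h"]) simp_all
  qed
  obtain a where a: "a \<in> carrier A" "a \<in> Q" "a \<notin> R" "a \<notin> S" using ex[OF p(2,3,4)] n by metis
  obtain b where b: "b \<in> carrier A" "b \<in> R" "b \<notin> Q" "b \<notin> S" using ex[OF p(3,2,4)] n by metis
  obtain c where c: "c \<in> carrier A" "c \<in> S" "c \<notin> Q" "c \<notin> R" using ex[OF p(4,2,3)] n by metis
  define \<sigma> :: "nat \<Rightarrow> 'a" where "\<sigma> n = (if n = 0 then a else if n = 1 then b else c)" for n
  have "range \<sigma> \<subseteq> carrier A" using a b c by (simp add: \<sigma>_def image_subset_iff)
  from DHA_hval_in_prime_filter[OF p(1) this diamond_system.forces_width, of 0 1 2]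
  have "himp A a (b \<squnion>\<^bsub>A\<^esub> c) \<squnion>\<^bsub>A\<^esub> (himp A b (a \<squnion>\<^bsub>A\<^esub> c) \<squnion>\<^bsub>A\<^esub> himp A c (a \<squnion>\<^bsub>A\<^esub> b)) \<in> P"
    by (simp add: \<sigma>_def)
  then consider "himp A a (b \<squnion>\<^bsub>A\<^esub> c) \<in> Q" | "himp A b (a \<squnion>\<^bsub>A\<^esub> c) \<in> R" | "himp A c (a \<squnion>\<^bsub>A\<^esub> b) \<in> S"
    using prime_filter_join[OF p(1)] a(1) b(1) c(1) sub by (auto simp: himp_closed)
  then show False
  proof cases
    case 1 
    then have "b \<squnion>\<^bsub>A\<^esub> c \<in> Q" using prime_filter_mp[OF p(2) a(2)] b c by simp
    then show False using prime_filter_join[OF p(2) b(1) c(1)] b c by simp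
  next
    case 2
    then have "a \<squnion>\<^bsub>A\<^esub> c \<in> R" using prime_filter_mp[OF p(3) b(2)] a c by simp
    then show False using prime_filter_join[OF p(3) a(1) c(1)] a c by simp
  next
    case 3
    then have "a \<squnion>\<^bsub>A\<^esub> b \<in> S" using prime_filter_mp[OF p(4) c(2)] a b by simp
    then show False using prime_filter_join[OF p(4) a(1) b(1)] a b by simp
  qed
qed

text \<open>If no prime filter contained both, some \<open>a\<close> in \<open>Q\<close> and
  \<open>b\<close> in \<open>R\<close> would have meet \<open>\<bottom>\<close>. Then the negation
  of \<open>a\<close> lies in \<open>R\<close>, while weak excluded middle in \<open>P\<close> puts
  it into \<open>Q\<close> or its own negation into \<open>R\<close>.\<close>

lemma prime_upper_bound:
  assumes p: "prime_filter A P" "prime_filter A Q" "prime_filter A R" and sub: "P \<subseteq> Q" "P \<subseteq> R"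
  obtains W where "prime_filter A W" "Q \<subseteq> W" "R \<subseteq> W"
proof (rule prime_filter_between[OF p(2,3)[THEN prime_filter_lattice_filter]
      lattice_ideal_bottom lattice_ideal_bottom])
  fix a b i j assume ab: "a \<in> Q" "b \<in> R" "i \<in> {\<bottom>\<^bsub>A\<^esub>}" "j \<in> {\<bottom>\<^bsub>A\<^esub>}"
  then have cl: "a \<in> carrier A" "b \<in> carrier A"
    using prime_filterD(1)[OF p(2)] prime_filterD(1)[OF p(3)] by auto
  show "\<not> a \<sqinter>\<^bsub>A\<^esub> b \<sqsubseteq>\<^bsub>A\<^esub> i \<squnion>\<^bsub>A\<^esub> j"
  proof
    assume "a \<sqinter>\<^bsub>A\<^esub> b \<sqsubseteq>\<^bsub>A\<^esub> i \<squnion>\<^bsub>A\<^esub> j"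
    moreover have "i \<squnion>\<^bsub>A\<^esub> j = \<bottom>\<^bsub>A\<^esub>" using ab join_le[of "\<bottom>\<^bsub>A\<^esub>" "\<bottom>\<^bsub>A\<^esub>" "\<bottom>\<^bsub>A\<^esub>"] by (simp add: le_antisym)
    ultimately have "b \<sqsubseteq>\<^bsub>A\<^esub> himp A a \<bottom>\<^bsub>A\<^esub>"
      using himp_residual[of a "\<bottom>\<^bsub>A\<^esub>" b] cl by (simp add: meet_comm)
    then have neg: "himp A a \<bottom>\<^bsub>A\<^esub> \<in> R"
      using prime_filterD(4)[OF p(3) ab(2)] cl by (simp add: himp_closed)
    have "range (\<lambda>n::nat. a) \<subseteq> carrier A" using cl by simp
    from DHA_hval_in_prime_filter[OF p(1) this diamond_system.forces_weak_excluded_middle]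
    have "himp A a \<bottom>\<^bsub>A\<^esub> \<squnion>\<^bsub>A\<^esub> himp A (himp A a \<bottom>\<^bsub>A\<^esub>) \<bottom>\<^bsub>A\<^esub> \<in> P" by simp
    then consider "himp A a \<bottom>\<^bsub>A\<^esub> \<in> Q" | "himp A (himp A a \<bottom>\<^bsub>A\<^esub>) \<bottom>\<^bsub>A\<^esub> \<in> R"
      using prime_filter_join[OF p(1)] cl sub by (auto simp: himp_closed)
    then show False
      using prime_filter_mp[OF p(2) ab(1) bottom_closed] prime_filter_mp[OF p(3) neg bottom_closed]
        prime_filter_bottom[OF p(2)] prime_filter_bottom[OF p(3)] by metis
  qed
qed (use that in simp)

text \<open>A prime filter containing \<open>Q\<close> and \<open>R\<close> and missing the
  complements of \<open>S\<close> and \<open>T\<close> is wanted. In the incomparable case, an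
  obstruction to it keeps the term of \<open>forces_interpolation\<close> out of
  \<open>P\<close>.\<close>

lemma prime_interpolation:
  assumes p: "prime_filter A P" "prime_filter A Q" "prime_filter A R" "prime_filter A S"
      "prime_filter A T"
    and sub: "P \<subseteq> Q" "P \<subseteq> R" "Q \<subseteq> S" "Q \<subseteq> T" "R \<subseteq> S" "R \<subseteq> T"
  obtains W where "prime_filter A W" "Q \<subseteq> W" "R \<subseteq> W" "W \<subseteq> S" "W \<subseteq> T"
proof (cases "Q \<subseteq> R \<or> R \<subseteq> Q")
  case True
  \<comment> \<open>The larger of \<open>Q\<close> and \<open>R\<close> interpolates.\<close>
  then show thesis using that p sub by blast
next
  case False
  obtain q where q: "q \<in> carrier A" "q \<in> Q" "q \<notin> R"
    using prime_filter_not_subsetE[OF p(2)] False by metis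
  obtain r where r: "r \<in> carrier A" "r \<in> R" "r \<notin> Q"
    using prime_filter_not_subsetE[OF p(3)] False by metis
  show thesis
  proof (rule prime_filter_between[OF p(2,3)[THEN prime_filter_lattice_filter]
        p(4,5)[THEN lattice_ideal_prime_complement]])
    fix a' b' c d
    assume ab': "a' \<in> Q" "b' \<in> R" and cd: "c \<in> carrier A - S" "d \<in> carrier A - T"
    have cl: "a' \<in> carrier A" "b' \<in> carrier A" "c \<in> carrier A" "d \<in> carrier A"
      using prime_filterD(1)[OF p(2)] prime_filterD(1)[OF p(3)] ab' cd by auto
    \<comment> \<open>Meeting with \<open>q\<close> and \<open>r\<close> preserves the inequality
      and adds \<open>a \<notin> R\<close> and \<open>b \<notin> Q\<close>, which later exclude
      \<open>himp A b a \<in> R\<close> and the disjunct \<open>b\<close> in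
      \<open>Q\<close>.\<close>
    define a b where "a = a' \<sqinter>\<^bsub>A\<^esub> q" and "b = b' \<sqinter>\<^bsub>A\<^esub> r"
    have ab: "a \<in> carrier A" "b \<in> carrier A" "a \<in> Q" "b \<in> R" "a \<notin> R" "b \<notin> Q"
      using prime_filter_meet[OF p(2)] prime_filter_meet[OF p(3)] cl q r ab'
      by (simp_all add: a_def b_def)
    show "\<not> a' \<sqinter>\<^bsub>A\<^esub> b' \<sqsubseteq>\<^bsub>A\<^esub> c \<squnion>\<^bsub>A\<^esub> d"
    proof
      assume le': "a' \<sqinter>\<^bsub>A\<^esub> b' \<sqsubseteq>\<^bsub>A\<^esub> c \<squnion>\<^bsub>A\<^esub> d"
      have "a \<sqinter>\<^bsub>A\<^esub> b \<sqsubseteq>\<^bsub>A\<^esub> a' \<sqinter>\<^bsub>A\<^esub> b'"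
        using cl q r by (simp add: a_def b_def meet_mono meet_left)
      then have le: "a \<sqinter>\<^bsub>A\<^esub> b \<sqsubseteq>\<^bsub>A\<^esub> c \<squnion>\<^bsub>A\<^esub> d"
        using le_trans[OF _ le'] cl ab by simp
      \<comment> \<open>The join of \<open>c\<close> and \<open>d\<close> lies in both
        \<open>S\<close> and \<open>T\<close>. As \<open>c\<close> is outside \<open>S\<close> and
        \<open>d\<close> outside \<open>T\<close>, primeness selects the other element in
        each.\<close>
      have inS: "d \<in> S" and inT: "c \<in> T"
      proof -
        have "a \<sqinter>\<^bsub>A\<^esub> b \<in> S" "a \<sqinter>\<^bsub>A\<^esub> b \<in> T"
          using ab sub prime_filter_meet[OF p(4)] prime_filter_meet[OF p(5)] by (simp_all add: subsetD)
        then have "c \<squnion>\<^bsub>A\<^esub> d \<in> S" "c \<squnion>\<^bsub>A\<^esub> d \<in> T"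
          using prime_filterD(4)[OF p(4) _ _ le] prime_filterD(4)[OF p(5) _ _ le] cl by simp_all
        then show "d \<in> S" "c \<in> T"
          using prime_filter_join[OF p(4) cl(3,4)] prime_filter_join[OF p(5) cl(3,4)] cd by simp_all
      qed
      \<comment> \<open>The inequality makes the premise of the interpolation term equal to the top
        element, which lies in \<open>P\<close>.\<close>
      have top: "\<top>\<^bsub>A\<^esub> \<sqsubseteq>\<^bsub>A\<^esub> himp A (a \<sqinter>\<^bsub>A\<^esub> b) (c \<squnion>\<^bsub>A\<^esub> d)"
        using himp_residual[of "a \<sqinter>\<^bsub>A\<^esub> b" "c \<squnion>\<^bsub>A\<^esub> d" "\<top>\<^bsub>A\<^esub>"] le ab cl
          le_trans[OF meet_right[of "\<top>\<^bsub>A\<^esub>" "a \<sqinter>\<^bsub>A\<^esub> b"] le] by simp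
      have premise: "himp A (a \<sqinter>\<^bsub>A\<^esub> b) (c \<squnion>\<^bsub>A\<^esub> d) \<in> P"
        using prime_filterD(4)[OF p(1) prime_filter_top[OF p(1)] _ top] ab cl by (simp add: himp_closed)
      define \<sigma> :: "nat \<Rightarrow> 'a"
        where "\<sigma> n = (if n = 0 then a else if n = 1 then b else if n = 2 then c else d)" for n
      have "range \<sigma> \<subseteq> carrier A" using ab cl by (simp add: \<sigma>_def image_subset_iff)
      from DHA_hval_in_prime_filter[OF p(1) this diamond_system.forces_interpolation, of 0 1 2 3]
      have "himp A (himp A (a \<sqinter>\<^bsub>A\<^esub> b) (c \<squnion>\<^bsub>A\<^esub> d))
          (himp A a (b \<squnion>\<^bsub>A\<^esub> (himp A c d \<squnion>\<^bsub>A\<^esub> himp A d c)) \<squnion>\<^bsub>A\<^esub> himp A b a) \<in> P"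
        by (simp add: \<sigma>_def)
      then have "himp A a (b \<squnion>\<^bsub>A\<^esub> (himp A c d \<squnion>\<^bsub>A\<^esub> himp A d c)) \<squnion>\<^bsub>A\<^esub> himp A b a \<in> P"
        using prime_filter_mp[OF p(1) premise] ab cl by (simp add: himp_closed)
      then consider "himp A a (b \<squnion>\<^bsub>A\<^esub> (himp A c d \<squnion>\<^bsub>A\<^esub> himp A d c)) \<in> Q" | "himp A b a \<in> R"
        using prime_filter_join[OF p(1)] ab cl sub by (auto simp: himp_closed)
      then show False
      proof cases
        case 1
        then have "b \<squnion>\<^bsub>A\<^esub> (himp A c d \<squnion>\<^bsub>A\<^esub> himp A d c) \<in> Q"
          using prime_filter_mp[OF p(2) ab(3)] ab cl by (simp add: himp_closed)
        then have "himp A c d \<in> Q \<or> himp A d c \<in> Q"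
          using prime_filter_join[OF p(2)] ab cl by (simp add: himp_closed)
        then show False
          using prime_filter_mp[OF p(5) inT cl(4)] prime_filter_mp[OF p(4) inS cl(3)] cd sub by auto
      next
        case 2
        then show False using prime_filter_mp[OF p(3) ab(4,1)] ab by simp
      qed
    qed
  next
    fix W assume W: "prime_filter A W" "Q \<subseteq> W" "R \<subseteq> W" "W \<inter> (carrier A - S) = {}"
      "W \<inter> (carrier A - T) = {}"
    have "W \<subseteq> S" "W \<subseteq> T" using prime_filterD(1)[OF W(1)] W(4,5) by blast+
    then show thesis using that W by metis
  qed
qed

end

text \<open>The lemmas on prime filters are applied with root \<open>P\<close>, which is also the
  common lower bound. Each upper bound or interpolant contains a member of \<open>?Y\<close>, hence
  \<open>P\<close>, and so stays in \<open>?Y\<close>.\<close>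

lemma diamond_sequence_up_prime_spectrum:
  fixes A :: "'a heyting"
  assumes A: "A \<in> DHA" and P: "P \<in> carrier (prime_spectrum A)"
  shows "diamond_sequence (prime_spectrum A\<lparr>carrier := up (prime_spectrum A) P\<rparr>)"
    (is "diamond_sequence ?Y")
proof -
  have carrier: "Q \<in> carrier ?Y \<longleftrightarrow> prime_filter A Q \<and> P \<subseteq> Q"
    and le: "Q \<sqsubseteq>\<^bsub>?Y\<^esub> R \<longleftrightarrow> Q \<subseteq> R" for Q R
    by (auto simp: up_def prime_spectrum_def)
  have P: "prime_filter A P" using P by (simp add: prime_spectrum_def)
  interpret partial_order ?Y
    by unfold_locales (auto simp: prime_spectrum_def)
  show ?thesis
  proof unfold_locales
    fix Q assume Q: "Q \<in> carrier ?Y"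
    have up: "R \<in> up ?Y Q \<longleftrightarrow> prime_filter A R \<and> P \<subseteq> R \<and> Q \<subseteq> R" for R
      unfolding up_def[of ?Y] by (simp only: mem_Collect_eq carrier le conj_assoc)
    show "three_point_rule (?Y\<lparr>carrier := up ?Y Q\<rparr>)"
      unfolding three_point_rule_def incomparable_def
    proof (intro ballI impI)
      fix R S T
      assume *: "R \<in> carrier (?Y\<lparr>carrier := up ?Y Q\<rparr>)" "S \<in> carrier (?Y\<lparr>carrier := up ?Y Q\<rparr>)"
        "T \<in> carrier (?Y\<lparr>carrier := up ?Y Q\<rparr>)" "R \<noteq> S \<and> R \<noteq> T \<and> S \<noteq> T"
        "\<not> R \<sqsubseteq>\<^bsub>?Y\<lparr>carrier := up ?Y Q\<rparr>\<^esub> S \<and> \<not> S \<sqsubseteq>\<^bsub>?Y\<lparr>carrier := up ?Y Q\<rparr>\<^esub> R"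
        "R \<sqsubseteq>\<^bsub>?Y\<lparr>carrier := up ?Y Q\<rparr>\<^esub> T"
      then have "prime_filter A R" "prime_filter A S" "prime_filter A T" "P \<subseteq> R" "P \<subseteq> S"
        "R \<subseteq> T" "R \<noteq> T" "\<not> R \<subseteq> S"
        using up by (simp_all add: prime_spectrum_def)
      then have "S \<subseteq> T" using prime_three_point[OF A P] by metis
      then show "S \<sqsubseteq>\<^bsub>?Y\<lparr>carrier := up ?Y Q\<rparr>\<^esub> T" by (simp add: prime_spectrum_def)
    qed
    show "\<not> (\<exists>S\<subseteq>up ?Y Q. antichain ?Y S \<and> card S = 3)"
    proof clarify
      fix S assume S: "S \<subseteq> up ?Y Q" "antichain ?Y S" "card S = 3"
      then obtain R T U where RTU: "S = {R, T, U}" "R \<noteq> T" "R \<noteq> U" "T \<noteq> U"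
        by (auto simp: card_3_iff)
      then have "prime_filter A R" "prime_filter A T" "prime_filter A U" "P \<subseteq> R" "P \<subseteq> T" "P \<subseteq> U"
        using S(1) up by blast+
      then have "R \<subseteq> T \<or> T \<subseteq> R \<or> R \<subseteq> U \<or> U \<subseteq> R \<or> T \<subseteq> U \<or> U \<subseteq> T"
        using prime_width[OF A P] by metis
      then show False
        using S(2) RTU unfolding antichain_def incomparable_def le by auto
    qed
    fix R S assume "R \<in> up ?Y Q" "S \<in> up ?Y Q"
    then have "prime_filter A R" "prime_filter A S" "P \<subseteq> R" "P \<subseteq> S" by (simp_all add: up)
    then obtain W where "prime_filter A W" "R \<subseteq> W" "S \<subseteq> W"
      using prime_upper_bound[OF A P] by metis
    then show "\<exists>W\<in>carrier ?Y. R \<sqsubseteq>\<^bsub>?Y\<^esub> W \<and> S \<sqsubseteq>\<^bsub>?Y\<^esub> W"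
      unfolding le using \<open>P \<subseteq> R\<close> by (intro bexI[of _ W]) (auto simp only: carrier)
  next
    fix B Q R S T U
    assume "B \<in> carrier ?Y" "Q \<in> carrier ?Y" "R \<in> carrier ?Y" "S \<in> carrier ?Y" "T \<in> carrier ?Y"
      and le': "Q \<sqsubseteq>\<^bsub>?Y\<^esub> S" "Q \<sqsubseteq>\<^bsub>?Y\<^esub> T" "R \<sqsubseteq>\<^bsub>?Y\<^esub> S" "R \<sqsubseteq>\<^bsub>?Y\<^esub> T"
    then have p: "prime_filter A Q" "prime_filter A R" "prime_filter A S" "prime_filter A T"
      "P \<subseteq> Q" "P \<subseteq> R"
      by (simp_all only: carrier)
    obtain W where "prime_filter A W" "Q \<subseteq> W" "R \<subseteq> W" "W \<subseteq> S" "W \<subseteq> T"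
      using prime_interpolation[OF A P p le'[unfolded le]] by metis
    then show "\<exists>W\<in>carrier ?Y. Q \<sqsubseteq>\<^bsub>?Y\<^esub> W \<and> R \<sqsubseteq>\<^bsub>?Y\<^esub> W \<and> W \<sqsubseteq>\<^bsub>?Y\<^esub> S \<and> W \<sqsubseteq>\<^bsub>?Y\<^esub> T"
      unfolding le using \<open>P \<subseteq> Q\<close> by (intro bexI[of _ W]) (auto simp only: carrier)
  next
    fix Q R assume "Q \<in> carrier ?Y" "R \<in> carrier ?Y"
    then show "\<exists>W\<in>carrier ?Y. W \<sqsubseteq>\<^bsub>?Y\<^esub> Q \<and> W \<sqsubseteq>\<^bsub>?Y\<^esub> R"
      unfolding le using P by (intro bexI[of _ P]) (auto simp only: carrier)
  qed
qed

section \<open>Reduction of equations to finite diamond sequences\<close>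

lemma Up_in_DHA:
  fixes X :: "'a gorder"
  assumes X: "partial_order X"
    and rooted: "\<And>x. x \<in> carrier X \<Longrightarrow> diamond_sequence (X\<lparr>carrier := up X x\<rparr>)"
  shows "Up X \<in> DHA"
proof -
  \<comment> \<open>Forcing at \<open>x\<close> depends only on \<open>up X x\<close>. A finite
    retract of this diamond sequence, coloured by the variables of \<open>s\<close> and
    \<open>t\<close>, is isomorphic to a poset on \<open>nat\<close> and therefore obeys
    \<open>E\<close>.\<close>
  have "forces X \<sigma> x s = forces X \<sigma> x t"
    if E: "\<And>N :: nat gorder. \<lbrakk>finite (carrier N); diamond_sequence N\<rbrakk> \<Longrightarrow> satisfies (Up N) E"
      and st: "(s, t) \<in> E" and U: "\<And>n. upset X (\<sigma> n)" and x: "x \<in> carrier X" for E \<sigma> s t x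
  proof -
    define Y where "Y = X\<lparr>carrier := up X x\<rparr>"
    have YX: "y \<in> carrier X" if "y \<in> carrier Y" for y using that by (simp add: Y_def up_def)
    have le: "le Y = le X" by (simp add: Y_def)
    interpret X: partial_order X by fact
    interpret Y: diamond_sequence Y unfolding Y_def by (rule rooted[OF x])
    have xY: "x \<in> carrier Y" using x by (simp add: Y_def up_def)
    have upx: "up Y x = carrier Y" by (auto simp: up_def Y_def)
    have upY: "up Y y = up X y" if "y \<in> carrier Y" for y
      using that x X.le_trans[of x y] by (auto simp: up_def Y_def)
    define V where "V = set_hterm s \<union> set_hterm t"
    have fV: "finite V" unfolding V_def by (metis finite_Un hterm.set_finite)
    \<comment> \<open>Restricting to \<open>V\<close> leaves finitely many colours. They are ordered
      by inclusion, and \<open>c\<close> is monotone since each \<open>\<sigma> n\<close> is an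
      upset.\<close>
    define c where "c y = {n \<in> V. y \<in> \<sigma> n}" for y
    have tp: "three_point_rule Y"
      using Y.D1[OF xY] unfolding upx by (simp add: three_point_rule_def incomparable_def)
    have width: "\<not> (\<exists>S. antichain Y S \<and> card S = 3)"
      using Y.D2[OF xY] unfolding upx antichain_def by metis
    have mono: "c y \<subseteq> c z" if "y \<in> carrier Y" "z \<in> carrier Y" "y \<sqsubseteq>\<^bsub>Y\<^esub> z" for y z
      using that upset_memD[OF U] YX unfolding c_def le by auto
    have fin: "finite (c ` carrier Y)"
      by (rule finite_subset[of _ "Pow V"]) (auto simp: c_def fV)
    obtain r where r: "r \<in> carrier Y \<rightarrow> carrier Y" "finite (r ` carrier Y)"
      and idem: "\<And>y. y \<in> carrier Y \<Longrightarrow> r (r y) = r y"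
      and rc: "\<And>y. y \<in> carrier Y \<Longrightarrow> c (r y) = c y"
      and rm: "\<And>y z. \<lbrakk>y \<in> carrier Y; z \<in> carrier Y; y \<sqsubseteq>\<^bsub>Y\<^esub> z\<rbrakk> \<Longrightarrow> r y \<sqsubseteq>\<^bsub>Y\<^esub> r z"
      and lift: "\<And>y z. \<lbrakk>y \<in> carrier Y; z \<in> carrier Y; r y \<sqsubseteq>\<^bsub>Y\<^esub> r z\<rbrakk> \<Longrightarrow>
        \<exists>w\<in>carrier Y. y \<sqsubseteq>\<^bsub>Y\<^esub> w \<and> r w = r z"
      by (rule Y.finite_colour_retraction[OF tp width _ fin]) (erule (2) mono, rule that)
    \<comment> \<open>The generators of \<open>DHA\<close> are posets on \<open>nat\<close>, so the
      image of \<open>r\<close> is coded by \<open>e\<close> and its order is transported along the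
      decoding \<open>g\<close>.\<close>
    obtain e :: "'a \<Rightarrow> nat" where e: "inj_on e (r ` carrier Y)"
      using finite_imp_inj_to_nat_seg[OF r(2)] by metis
    define g where "g = inv_into (r ` carrier Y) e"
    define f where "f = e \<circ> r"
    define N :: "nat gorder" where
      "N = \<lparr>carrier = f ` carrier Y, eq = (=), le = (\<lambda>m n. g m \<sqsubseteq>\<^bsub>Y\<^esub> g n)\<rparr>"
    have gf: "g (f y) = r y" if "y \<in> carrier Y" for y
      using e that by (simp add: g_def f_def)
    have rY: "r y \<in> carrier Y" if "y \<in> carrier Y" for y using r(1) that by auto
    have gY: "g m \<in> carrier Y" and fg: "f (g m) = m" if "m \<in> carrier N" for m
      using that gf rY idem by (auto simp: N_def f_def)
    have poN: "partial_order N"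
    proof unfold_locales
      show "(.=\<^bsub>N\<^esub>) = (=)" by (simp add: N_def)
      fix k m n assume k: "k \<in> carrier N" "m \<in> carrier N" "n \<in> carrier N"
        "k \<sqsubseteq>\<^bsub>N\<^esub> m" "m \<sqsubseteq>\<^bsub>N\<^esub> n"
      then show "k \<sqsubseteq>\<^bsub>N\<^esub> n" using Y.le_trans[of "g k" "g m" "g n"] gY by (simp add: N_def)
    next
      fix m n assume m: "m \<in> carrier N" "n \<in> carrier N" "m \<sqsubseteq>\<^bsub>N\<^esub> n" "n \<sqsubseteq>\<^bsub>N\<^esub> m"
      then have "g m = g n" using Y.le_antisym[of "g m" "g n"] gY by (simp add: N_def)
      then have "m = n" using fg m by metis
      then show "m .=\<^bsub>N\<^esub> n" by (simp add: N_def)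
    next
      fix m assume "m \<in> carrier N"
      then show "m \<sqsubseteq>\<^bsub>N\<^esub> m" using Y.le_refl[OF gY] by (simp add: N_def)
    qed (simp_all add: N_def)
    have fm: "f y \<sqsubseteq>\<^bsub>N\<^esub> f z" if "y \<in> carrier Y" "z \<in> carrier Y" "y \<sqsubseteq>\<^bsub>Y\<^esub> z" for y z
      using that rm by (simp add: N_def gf)
    have fN: "f y \<in> carrier N" if "y \<in> carrier Y" for y using that by (simp add: N_def)
    have dN: "diamond_sequence N"
    proof (rule diamond_sequence_retract[OF Y.diamond_sequence_axioms poN, of f g])
      show "g m \<sqsubseteq>\<^bsub>Y\<^esub> g n" if "m \<sqsubseteq>\<^bsub>N\<^esub> n" for m n using that by (simp add: N_def)
    qed (use fN gY fg fm in \<open>auto\<close>)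
    have finN: "finite (carrier N)"
      using finite_imageI[OF r(2), of e] by (simp add: N_def f_def image_comp)
    \<comment> \<open>This valuation is pulled back along \<open>g\<close>. For variables in
      \<open>V\<close> it matches \<open>\<sigma>\<close> along \<open>f\<close>, because
      \<open>r\<close> preserves colours.\<close>
    define \<tau> where "\<tau> n = {m \<in> carrier N. g m \<in> \<sigma> n}" for n
    have UN: "upset N (\<tau> n)" for n
      unfolding upset_def
    proof (intro conjI ballI subsetI)
      fix m k assume m: "m \<in> \<tau> n" "k \<in> up N m"
      then have "g k \<in> \<sigma> n"
        using upset_memD[OF U, of "g m" n "g k"] gY[THEN YX] by (simp add: \<tau>_def up_def N_def le)
      then show "k \<in> \<tau> n" using m by (simp add: \<tau>_def up_def)
    qed (simp add: \<tau>_def)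
    have YN: "forces Y \<sigma> x u \<longleftrightarrow> forces N \<tau> (f x) u" if u: "set_hterm u \<subseteq> V" for u
    proof (rule forces_p_morphism[OF fN _ _ _ xY])
      show "f z \<in> up N (f y)" if "y \<in> carrier Y" "z \<in> up Y y" for y z
        using that fm fN by (simp add: up_def)
      show "\<exists>w\<in>up Y y. f w = m" if y: "y \<in> carrier Y" and m: "m \<in> up N (f y)" for y m
      proof -
        obtain z where z: "z \<in> carrier Y" "m = f z" using m by (auto simp: up_def N_def)
        then have "r y \<sqsubseteq>\<^bsub>Y\<^esub> r z" using y m by (simp add: up_def N_def gf)
        then obtain w where "w \<in> carrier Y" "y \<sqsubseteq>\<^bsub>Y\<^esub> w" "r w = r z"
          using lift[OF y z(1)] by metis
        then show ?thesis using z by (intro bexI[of _ w]) (simp_all add: f_def up_def)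
      qed
      show "y \<in> \<sigma> v \<longleftrightarrow> f y \<in> \<tau> v" if "v \<in> set_hterm u" "y \<in> carrier Y" for v y
        using rc[OF that(2)] that u fN gf by (auto simp: c_def \<tau>_def)
    qed
    \<comment> \<open>The inclusion of \<open>Y\<close> into \<open>X\<close> is a p-morphism, as
      \<open>Y\<close> is an upset of \<open>X\<close>.\<close>
    have XY: "forces Y \<sigma> x u \<longleftrightarrow> forces X \<sigma> x u" for u
      using forces_p_morphism[of Y id X u \<sigma> \<sigma> x] YX upY xY by simp
    have "hval (Up N) \<tau> s = hval (Up N) \<tau> t"
      using E[OF finN dN] st UN by (fastforce simp: satisfies_def Up_def)
    then have "forces N \<tau> (f x) s \<longleftrightarrow> forces N \<tau> (f x) t"
      using mem_hval_Up_iff[of N s \<tau>, OF poN UN fN[OF xY]]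
        mem_hval_Up_iff[of N t \<tau>, OF poN UN fN[OF xY]] by simp
    then show ?thesis using XY YN by (simp add: V_def)
  qed
  note key = this
  have "satisfies (Up X) E"
    if E: "\<And>N :: nat gorder. \<lbrakk>finite (carrier N); diamond_sequence N\<rbrakk> \<Longrightarrow> satisfies (Up N) E" for E
    unfolding satisfies_def
  proof (clarify)
    fix s t and \<sigma> :: "nat \<Rightarrow> 'a set"
    assume st: "(s, t) \<in> E" and "range \<sigma> \<subseteq> carrier (Up X)"
    then have U: "\<And>n. upset X (\<sigma> n)" by (auto simp: Up_def)
    have "hval (Up X) \<sigma> u = {x \<in> carrier X. forces X \<sigma> x u}" for u
      using upset_hval[of X u \<sigma>, OF X U] mem_hval_Up_iff[of X u \<sigma>, OF X U]
      unfolding upset_def by blast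
    then show "hval (Up X) \<sigma> s = hval (Up X) \<sigma> t"
      using key[of E s t \<sigma>, OF E st U] by auto
  qed
  then show ?thesis
    using heyting_algebra_Up[OF X] by (auto simp: DHA_def variety_generated_def)
qed

theorem theorem7p3:
  fixes A :: "'a heyting"
  assumes "A \<in> DHA"
  shows "Up (prime_spectrum A) \<in> DHA"
  using Up_in_DHA[OF partial_order_prime_spectrum diamond_sequence_up_prime_spectrum[OF assms]] .

end
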